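(* Let $a^2\ge0$, $b^2>0$, $c^2>0$, $k\in\mathbb Z\setminus\{0\}$ and $R\in(0,\infty]$. Let $(u,v)$ be a solution on $(0,R)$ of $$u''+\frac{u'}{r}-\frac{k^2u}{r^2}=h(u,v),\qquad v''+\frac{v'}{r}=g(u,v),$$ with $u(0)=0$, $v'(0)=0$, $u(R)=\frac{s_+}{\sqrt2}$, $v(R)=-\frac{s_+}{\sqrt6}$ (limits as $r\to\infty$ if $R=\infty$), such that $u>0$ and $v<0$ on $(0,R)$. Then: (i) if $b^4<3a^2c^2$, then $u'>0$ and $v'>0$ on $(0,R)$; (ii) if $b^4=3a^2c^2$, then $u'>0$ on $(0,R)$ and $v\equiv-\frac{s_+}{\sqrt6}$; (iii) if $b^4>3a^2c^2$, then $u'>0$ and $v'<0$ on $(0,R)$.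
   Context: $s_+=\frac{b^2+\sqrt{b^4+24a^2c^2}}{4c^2}$, $h(u,v)=u\big[-a^2+\sqrt{\tfrac23}b^2v+c^2(u^2+v^2)\big]$, $g(u,v)=v\big[-a^2-\tfrac1{\sqrt6}b^2v+c^2(u^2+v^2)\big]+\tfrac1{\sqrt6}b^2u^2$. *)

theory Defs
  imports "HOL-Analysis.Analysis"
begin

definition s_plus :: "real \<Rightarrow> real \<Rightarrow> real \<Rightarrow> real" where
  "s_plus a b c = (b^2 + sqrt (b^4 + 24 * a^2 * c^2)) / (4 * c^2)"

definition hfun :: "real \<Rightarrow> real \<Rightarrow> real \<Rightarrow> real \<Rightarrow> real \<Rightarrow> real" where
  "hfun a b c u v = u * (- (a^2) + sqrt (2/3) * b^2 * v + c^2 * (u^2 + v^2))"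

definition gfun :: "real \<Rightarrow> real \<Rightarrow> real \<Rightarrow> real \<Rightarrow> real \<Rightarrow> real" where
  "gfun a b c u v = v * (- (a^2) - (1 / sqrt 6) * b^2 * v + c^2 * (u^2 + v^2))
                    + (1 / sqrt 6) * b^2 * u^2"

definition end_filter :: "ereal \<Rightarrow> real filter" where
  "end_filter R = (if R = \<infinity> then at_top else at_left (real_of_ereal R))"

end

(* Normalise u = s_+ U / sqrt 2 and v = - s_+ V / sqrt 6, so that U and V tend to 1 at the outer end.
   The maximum principle for 3 U^2 + V^2 gives 3 U^2 + V^2 \<le> 4, and inside this ellipse it then shows
   that V stays on one side of 1 (below if b^4 > 3 a^2 c^2, above if b^4 < 3 a^2 c^2) and that U < 1.
   On the resulting range the system for (U, \<sigma> V) is cooperative, with \<sigma> = 1 resp. \<sigma> = - 1.  Monotonicity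
   follows by moving planes on the half-line: reflecting about \<kappa> keeps the profile ordered for \<kappa>
   near R, and the equation rules out that this order is lost as \<kappa> decreases to 0.  Reflection r \<mapsto> 2 \<kappa> - r is used
   rather than scaling because the nonlinearity in the V-equation has no sign, whereas
   the drift terms u'/r and the k^2/r^2 term both have the good sign under reflection. *)
theory Submission
  imports Defs
begin

section \<open>Calculus\<close>

text \<open>A reflection compares two states, so the sign of the coupling is needed for difference
  quotients and not only for derivatives; the bound \<open>\<sigma> V \<le> \<sigma>\<close>
  provides it. In one radial variable the strong maximum principle and Hopf's lemma shrink to
  elementary tests. A contact with the mirror image at an interior pair is a minimum of the
  difference. A vanishing slope at the mirror \<open>\<kappa>\<close> forces a sign on the third
  derivative, since the difference is odd there; this is why the equations are differentiated once.
  Three places lie outside these tests. At infinity no boundary slope starts the procedure, but an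
  algebraically decaying source in the equation for \<open>U'\<close> does. At the centre
  \<open>V\<close> has no prescribed value, and \<open>V'(0) = 0\<close> takes over. If
  \<open>b^4 = 3 a^2 c^2\<close> the coupling degenerates, but then both signs
  \<open>\<sigma>\<close> apply and pin \<open>V\<close> to 1.\<close>

lemma local_min_second_derivative:
  fixes f f1 :: "real \<Rightarrow> real"
  assumes "d > 0"
    and df: "\<And>y. \<bar>y - x\<bar> < d \<Longrightarrow> (f has_real_derivative f1 y) (at y)"
    and d1: "(f1 has_real_derivative D) (at x)"
    and min: "\<And>y. \<bar>y - x\<bar> < d \<Longrightarrow> f x \<le> f y"
  shows "f1 x = 0" "D \<ge> 0"
proof -
  show f1x: "f1 x = 0"
    using DERIV_local_min[OF df[of x] \<open>d > 0\<close>] min \<open>d > 0\<close> by (simp add: abs_minus_commute)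
  show "D \<ge> 0"
  proof (rule ccontr)
    assume "\<not> D \<ge> 0"
    then obtain e where e: "e > 0" "\<And>h. h > 0 \<Longrightarrow> h < e \<Longrightarrow> f1 (x + h) < f1 x"
      using has_real_derivative_neg_dec_right[OF d1] by auto
    define h where "h = min d e / 2"
    have h: "h > 0" "h < d" "h < e" using \<open>d > 0\<close> e(1) by (auto simp: h_def)
    have "f (x + h) < f x"
    proof (rule DERIV_neg_imp_decreasing_open[where f = f])
      show "continuous_on {x..x + h} f"
        by (rule DERIV_continuous_on[where D = f1], rule has_field_derivative_at_within, rule df)
          (use h in auto)
      show "\<exists>y. DERIV f z :> y \<and> y < 0" if "x < z" "z < x + h" for z
        using df[of z] e(2)[of "z - x"] that h f1x by auto
    qed (use h in auto)
    with min[of "x + h"] h show False by auto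
  qed
qed

text \<open>The odd function \<open>f (x + h) - f (x - h)\<close> expands as
  \<open>2 f'(x) h + D h^3 / 3 + ...\<close>. With \<open>f1 x = 0\<close> a nonzero cubic term
  decides its sign for small \<open>h > 0\<close>.\<close>

lemma reflection_third_derivative:
  fixes f f1 f2 :: "real \<Rightarrow> real"
  assumes "d > 0"
    and df: "\<And>y. \<bar>y - x\<bar> < d \<Longrightarrow> (f has_real_derivative f1 y) (at y)"
    and df1: "\<And>y. \<bar>y - x\<bar> < d \<Longrightarrow> (f1 has_real_derivative f2 y) (at y)"
    and df2: "(f2 has_real_derivative D) (at x)"
    and "f1 x = 0"
    and le: "\<And>h. 0 < h \<Longrightarrow> h < d \<Longrightarrow> f (x - h) \<le> f (x + h)"
  shows "D \<ge> 0"
proof (rule ccontr)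
  assume "\<not> D \<ge> 0"
  \<comment> \<open>This is \<open>2 D\<close>, the derivative of \<open>g2\<close> at 0, in the
    shape that the chain rule delivers.\<close>
  then have neg: "D * 1 - D * (-1) < 0" by simp
  define g where "g h = f (x + h) - f (x - h)" for h
  define g1 where "g1 h = f1 (x + h) + f1 (x - h)" for h
  define g2 where "g2 h = f2 (x + h) - f2 (x - h)" for h
  have g: "(g has_real_derivative g1 h) (at h)" if "\<bar>h\<bar> < d" for h
    unfolding g_def g1_def
    by (rule derivative_eq_intros DERIV_chain2[OF df] | use that in simp)+
  have g1: "(g1 has_real_derivative g2 h) (at h)" if "\<bar>h\<bar> < d" for h
    unfolding g1_def g2_def
    by (rule derivative_eq_intros DERIV_chain2[OF df1] | use that in simp)+
  have g2: "(g2 has_real_derivative (D * 1 - D * (-1))) (at 0)"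
    unfolding g2_def
  proof (rule DERIV_diff)
    show "((\<lambda>h. f2 (x + h)) has_real_derivative D * 1) (at 0)"
      by (rule DERIV_chain2[where f = f2]) (use df2 in \<open>auto intro!: derivative_eq_intros\<close>)
    show "((\<lambda>h. f2 (x - h)) has_real_derivative D * (-1)) (at 0)"
      by (rule DERIV_chain2[where f = f2]) (use df2 in \<open>auto intro!: derivative_eq_intros\<close>)
  qed
  obtain e where e: "e > 0" "\<And>h. h > 0 \<Longrightarrow> h < e \<Longrightarrow> g2 h < 0"
    using has_real_derivative_neg_dec_right[OF g2 neg] by (auto simp: g2_def)
  define h where "h = min d e / 2"
  have h: "h > 0" "h < d" "h < e" using \<open>d > 0\<close> e(1) by (auto simp: h_def)
  have g1neg: "g1 y < 0" if "0 < y" "y \<le> h" for y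
  proof -
    have "g1 y < g1 0"
    proof (rule DERIV_neg_imp_decreasing_open[OF \<open>0 < y\<close>])
      show "continuous_on {0..y} g1"
        by (rule DERIV_continuous_on[where D = g2], rule has_field_derivative_at_within, rule g1)
          (use h that in auto)
      show "\<exists>w. DERIV g1 z :> w \<and> w < 0" if "0 < z" "z < y" for z
        using g1[of z] e(2)[of z] that h \<open>y \<le> h\<close> by auto
    qed
    then show ?thesis using \<open>f1 x = 0\<close> by (simp add: g1_def)
  qed
  have "g h < g 0"
  proof (rule DERIV_neg_imp_decreasing_open[OF h(1)])
    show "continuous_on {0..h} g"
      by (rule DERIV_continuous_on[where D = g1], rule has_field_derivative_at_within, rule g)
        (use h in auto)
    show "\<exists>w. DERIV g z :> w \<and> w < 0" if "0 < z" "z < h" for z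
      using g[of z] g1neg[of z] that h by auto
  qed
  with le[OF h(1,2)] show False by (simp add: g_def)
qed

text \<open>One description for finite and infinite outer ends; \<open>N > 0\<close> keeps the whole
  tail inside the domain of the equations.\<close>

lemma eventually_end_filter:
  assumes "0 < R"
  shows "eventually P (end_filter R) \<longleftrightarrow>
    (\<exists>N>0. ereal N < R \<and> (\<forall>r>N. ereal r < R \<longrightarrow> P r))"
proof (cases R)
  case (real x)
  then have x: "0 < x" using assms by simp
  have "eventually P (end_filter R) \<longleftrightarrow> (\<exists>b<x. \<forall>y>b. y < x \<longrightarrow> P y)"
    using eventually_at_left[of 0 x P] x real by (simp add: end_filter_def)
  also have "\<dots> \<longleftrightarrow> (\<exists>N>0. ereal N < R \<and> (\<forall>r>N. ereal r < R \<longrightarrow> P r))"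
  proof
    assume "\<exists>b<x. \<forall>y>b. y < x \<longrightarrow> P y"
    then obtain b where "b < x" "\<forall>y>b. y < x \<longrightarrow> P y" by blast
    then show "\<exists>N>0. ereal N < R \<and> (\<forall>r>N. ereal r < R \<longrightarrow> P r)"
      using x real by (intro exI[of _ "max b (x / 2)"]) auto
  qed (use real in auto)
  finally show ?thesis .
next
  case PInf
  have "eventually P at_top \<longleftrightarrow> (\<exists>N>0. \<forall>r>N. P r)"
    unfolding eventually_at_top_dense
  proof
    assume "\<exists>N. \<forall>r>N. P r"
    then obtain N where "\<forall>r>N. P r" by blast
    then show "\<exists>N>0. \<forall>r>N. P r" by (intro exI[of _ "max N 1"]) auto
  qed blast
  then show ?thesis using PInf by (simp add: end_filter_def)
qed (use assms in auto)

lemma end_filter_neq_bot: "0 < R \<Longrightarrow> end_filter R \<noteq> bot"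
  by (simp add: end_filter_def)

text \<open>Adding a small multiple of \<open>ln r\<close>, which is harmonic in the plane and tends to
  \<open>-\<infinity>\<close> at the origin, forces an interior maximum.\<close>

lemma radial_max_principle:
  fixes f f1 f2 :: "real \<Rightarrow> real"
  assumes df: "\<And>r. 0 < r \<Longrightarrow> ereal r < R \<Longrightarrow> (f has_real_derivative f1 r) (at r)"
    and df1: "\<And>r. 0 < r \<Longrightarrow> ereal r < R \<Longrightarrow> (f1 has_real_derivative f2 r) (at r)"
    and bdd: "eventually (\<lambda>r. f r \<le> B) (at_right 0)"
    and lim: "(f \<longlongrightarrow> L) (end_filter R)" and "L \<le> M"
    and subh: "\<And>r. 0 < r \<Longrightarrow> ereal r < R \<Longrightarrow> M < f r \<Longrightarrow> 0 < f2 r + f1 r / r"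
    and r: "0 < r" "ereal r < R"
  shows "f r \<le> M"
proof (rule ccontr)
  assume "\<not> f r \<le> M"
  then have fr: "M < f r" by simp
  have Rpos: "0 < R" using r by (metis ereal_less(2) less_trans)
  have "eventually (\<lambda>x. f x < (M + f r) / 2) (end_filter R)"
    by (rule order_tendstoD(2)[OF lim]) (use \<open>L \<le> M\<close> fr in \<open>simp add: field_simps\<close>)
  then obtain N0 where N0: "N0 > 0" "ereal N0 < R"
      "\<And>x. x > N0 \<Longrightarrow> ereal x < R \<Longrightarrow> f x < (M + f r) / 2"
    unfolding eventually_end_filter[OF Rpos] by blast
  have "ereal (max N0 r) < R" using N0 r by (simp add: max_def)
  then obtain N where "ereal (max N0 r) < ereal N" "ereal N < R"
    using ereal_dense2 by blast
  then have N: "N > N0" "N > r" "ereal N < R" by auto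
  have fN: "f N < (M + f r) / 2" using N0(3) N by simp
  \<comment> \<open>The penalty at \<open>r\<close> costs a quarter of the excess
    \<open>f r - M\<close>. So \<open>g r\<close> stays above \<open>(M + f r) / 2\<close>, which
    exceeds \<open>g\<close> at both ends \<open>l\<close> and \<open>N\<close>.\<close>
  define \<epsilon> where "\<epsilon> = (f r - M) / (4 * (ln N - ln r))"
  have lnN: "ln r < ln N" using N r by simp
  have eps: "\<epsilon> > 0" using lnN fr by (simp add: \<epsilon>_def)
  define g where "g x = f x + \<epsilon> * (ln x - ln N)" for x
  have "g r = f r - (f r - M) / 4"
    using lnN by (simp add: g_def \<epsilon>_def field_simps)
  then have gr: "g r > (M + f r) / 2" using fr by (simp add: field_simps)
  have "eventually (\<lambda>x::real. ln x < (M - B) / \<epsilon> + ln N) (at_right 0)"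
    using ln_at_0 by (simp add: filterlim_at_bot_dense)
  with bdd have "eventually (\<lambda>x. g x < M) (at_right 0)"
    by eventually_elim (use eps in \<open>simp add: g_def field_simps\<close>)
  then obtain \<delta> where d: "\<delta> > 0" "\<And>x. 0 < x \<Longrightarrow> x < \<delta> \<Longrightarrow> g x < M"
    by (auto simp: eventually_at_right_field)
  define l where "l = min \<delta> r / 2"
  have l: "0 < l" "l < \<delta>" "l < r" using d r by (auto simp: l_def)
  have in_dom: "0 < x \<and> ereal x < R" if "l \<le> x" "x \<le> N" for x
    using that l N(3) by (meson ereal_less_eq(3) le_less_trans less_le_trans)
  have dg: "(g has_real_derivative f1 x + \<epsilon> / x) (at x)" if "0 < x" "ereal x < R" for x
    unfolding g_def using that by (auto intro!: derivative_eq_intros df)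
  have dg1: "((\<lambda>x. f1 x + \<epsilon> / x) has_real_derivative f2 x - \<epsilon> / x^2) (at x)"
    if "0 < x" "ereal x < R" for x
    using that by (auto intro!: derivative_eq_intros df1 simp: power2_eq_square)
  have "continuous_on {l..N} g"
    by (rule DERIV_continuous_on, rule has_field_derivative_at_within, rule dg) (use in_dom in auto)
  then obtain m where m: "m \<in> {l..N}" "\<And>y. y \<in> {l..N} \<Longrightarrow> g y \<le> g m"
    using continuous_attains_sup[of "{l..N}" g] l N by auto
  have gm: "g m \<ge> g r" using m(2)[of r] l N by simp
  have "m \<noteq> l" using d(2)[of l] l gm gr fr by (auto simp: field_simps)
  moreover have "m \<noteq> N" using gm gr fN by (auto simp: g_def)
  ultimately have mi: "l < m" "m < N" using m(1) by auto
  define e where "e = min (m - l) (N - m)"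
  have e: "e > 0" using mi by (simp add: e_def)
  have near: "l \<le> y" "y \<le> N" if "\<bar>y - m\<bar> < e" for y
    using that by (auto simp: e_def abs_less_iff)
  have max: "- g m \<le> - g y" if "\<bar>y - m\<bar> < e" for y
    using m(2)[of y] near[OF that] by simp
  have *: "((\<lambda>x. - g x) has_real_derivative - (f1 y + \<epsilon> / y)) (at y)" if "\<bar>y - m\<bar> < e" for y
    by (rule DERIV_minus, rule dg) (use in_dom[OF near[OF that]] in auto)
  have m0: "0 < m" "ereal m < R" using in_dom[of m] mi by auto
  have "- (f1 m + \<epsilon> / m) = 0" "0 \<le> - (f2 m - \<epsilon> / m^2)"
    using local_min_second_derivative[OF e * DERIV_minus[OF dg1[OF m0]] max] by auto
  then have "f1 m = - \<epsilon> / m" "f2 m \<le> \<epsilon> / m^2" by auto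
  then have "f2 m + f1 m / m \<le> 0" by (simp add: power2_eq_square)
  moreover have "f m \<ge> g m"
  proof -
    have "ln m \<le> ln N" using m0 mi by simp
    then show ?thesis using eps by (simp add: g_def mult_nonneg_nonpos)
  qed
  then have "f m > M" using gm gr fr by (simp add: field_simps)
  ultimately show False using subh[OF m0] by simp
qed

section \<open>Functions ordered by reflection\<close>

text \<open>All mirrors from \<open>\<kappa>\<close> outward are tested at once, since the midpoint
  of the pair is only bounded below. Hence the property weakens as \<open>\<kappa>\<close> grows.
  Pairs with an endpoint at 0 or at a finite \<open>R\<close> count too.\<close>

definition reflection_ordered :: "ereal \<Rightarrow> (real \<Rightarrow> real) \<Rightarrow> real \<Rightarrow> bool" where
  "reflection_ordered R f \<kappa> \<longleftrightarrow>
    (\<forall>r \<rho>. 0 \<le> r \<longrightarrow> r \<le> \<rho> \<longrightarrow> ereal \<rho> \<le> R \<longrightarrow> 2 * \<kappa> \<le> r + \<rho> \<longrightarrow> f r \<le> f \<rho>)"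

lemma reflection_orderedD:
  "reflection_ordered R f \<kappa> \<Longrightarrow> 0 \<le> r \<Longrightarrow> r \<le> \<rho> \<Longrightarrow> ereal \<rho> \<le> R \<Longrightarrow> 2 * \<kappa> \<le> r + \<rho> \<Longrightarrow> f r \<le> f \<rho>"
  by (simp add: reflection_ordered_def)

lemma reflection_ordered_mono:
  "reflection_ordered R f \<kappa> \<Longrightarrow> \<kappa> \<le> \<mu> \<Longrightarrow> reflection_ordered R f \<mu>"
  by (force simp: reflection_ordered_def)

text \<open>A pair with midpoint beyond \<open>\<kappa>\<close> either lies beyond \<open>N\<close>,
  where \<open>f\<close> increases, or has \<open>r < N < \<kappa> < \<rho>\<close>. In the second
  case \<open>f \<rho>\<close> is so close to \<open>L\<close> that it exceeds the maximum of
  \<open>f\<close> on \<open>{0..N}\<close>.\<close>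

lemma reflection_ordered_near_end:
  assumes R: "0 < R" and cont: "continuous_on {r. 0 \<le> r \<and> ereal r \<le> R} f"
    and lim: "(f \<longlongrightarrow> L) (end_filter R)" and fin: "\<And>x. ereal x = R \<Longrightarrow> f x = L"
    and lt: "\<And>r. 0 \<le> r \<Longrightarrow> ereal r < R \<Longrightarrow> f r < L"
    and N: "0 < N" "ereal N < R"
    and df: "\<And>r. N < r \<Longrightarrow> ereal r < R \<Longrightarrow> (f has_real_derivative f1 r) (at r)"
    and pos: "\<And>r. N < r \<Longrightarrow> ereal r < R \<Longrightarrow> 0 \<le> f1 r"
  shows "\<exists>\<kappa>>0. ereal \<kappa> < R \<and> reflection_ordered R f \<kappa>"
proof -
  have sub: "{a..b} \<subseteq> {r. 0 \<le> r \<and> ereal r \<le> R}" if "0 \<le> a" "ereal b \<le> R" for a b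
    using that by (auto intro: order_trans[OF _ that(2)])
  have "continuous_on {0..N} f"
    by (rule continuous_on_subset[OF cont]) (use sub[of 0 N] N in auto)
  then obtain m where m: "m \<in> {0..N}" "\<And>y. y \<in> {0..N} \<Longrightarrow> f y \<le> f m"
    using continuous_attains_sup[of "{0..N}" f] N by auto
  have "f m < L" using m N by (intro lt) (auto intro: le_less_trans[of _ "ereal N"])
  then have "eventually (\<lambda>x. f m < f x) (end_filter R)"
    using order_tendstoD(1)[OF lim] by simp
  then obtain N' where N': "N' > 0" "ereal N' < R" "\<And>x. x > N' \<Longrightarrow> ereal x < R \<Longrightarrow> f m < f x"
    unfolding eventually_end_filter[OF R] by blast
  have "ereal (max N N') < R" using N N' by (simp add: max_def)
  then obtain \<kappa> where "ereal (max N N') < ereal \<kappa>" "ereal \<kappa> < R" using ereal_dense2 by blast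
  then have l: "N < \<kappa>" "N' < \<kappa>" "ereal \<kappa> < R" by auto
  have "f r \<le> f \<rho>" if r: "0 \<le> r" "r \<le> \<rho>" "ereal \<rho> \<le> R" "2 * \<kappa> \<le> r + \<rho>" for r \<rho>
  proof (cases "N \<le> r")
    case True
    have "(f has_real_derivative f1 x) (at x)" "0 \<le> f1 x" if "r < x" "x < \<rho>" for x
      using df[of x] pos[of x] that True r(3)
      by (meson ereal_less(2) le_less_trans less_ereal.simps(1) less_le_trans)+
    then show ?thesis
      using DERIV_nonneg_imp_increasing_open[of r \<rho> f] r
        continuous_on_subset[OF cont sub[of r \<rho>]] by blast
  next
    case False
    then have "f r \<le> f m" using m r by simp
    also have "f m < f \<rho>"
    proof (cases "ereal \<rho> = R")
      case True
      then show ?thesis using fin \<open>f m < L\<close> by simp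
    next
      case False
      then show ?thesis using r l by (intro N'(3)) auto
    qed
    finally show ?thesis by simp
  qed
  then show ?thesis using l N by (intro exI[of _ \<kappa>]) (auto simp: reflection_ordered_def)
qed

text \<open>Moving the inner point of a pair outward raises the midpoint above
  \<open>\<kappa>\<close>; continuity at the inner point then gives the limit case. The outer point
  stays fixed since it may already be \<open>R\<close>.\<close>

lemma reflection_ordered_closed:
  assumes cont: "continuous_on {r. 0 \<le> r \<and> ereal r \<le> R} f"
    and ord: "\<And>\<mu>. \<kappa> < \<mu> \<Longrightarrow> ereal \<mu> < R \<Longrightarrow> reflection_ordered R f \<mu>"
  shows "reflection_ordered R f \<kappa>"
  unfolding reflection_ordered_def
proof (intro allI impI)
  fix r \<rho> :: real
  assume r: "0 \<le> r" "r \<le> \<rho>" "ereal \<rho> \<le> R" "2 * \<kappa> \<le> r + \<rho>"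
  show "f r \<le> f \<rho>"
  proof (cases "r = \<rho>")
    case False
    then have "r < \<rho>" using r by simp
    have "continuous_on {r..\<rho>} f"
      by (rule continuous_on_subset[OF cont]) (use r in \<open>auto intro: order_trans[OF _ r(3)]\<close>)
    then have "(f \<longlongrightarrow> f r) (at_right r)"
      using continuous_on_Icc_at_rightD \<open>r < \<rho>\<close> by blast
    moreover have "f x \<le> f \<rho>" if "r < x" "x < \<rho>" for x
    proof (rule reflection_orderedD[OF ord[of "(x + \<rho>) / 2"]])
      show "ereal ((x + \<rho>) / 2) < R" using that r(3) by (intro less_le_trans[OF _ r(3)]) simp
    qed (use that r in auto)
    then have "eventually (\<lambda>x. f x \<le> f \<rho>) (at_right r)"
      using \<open>r < \<rho>\<close> by (auto simp: eventually_at_right_field)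
    ultimately show ?thesis using tendsto_upperbound trivial_limit_at_right_real by blast
  qed simp
qed

text \<open>Compactness: pairs that violate the order for mirrors just below \<open>\<kappa>\<close>
  accumulate at a pair with midpoint \<open>\<kappa>\<close>. Strictness leaves only the degenerate
  pair \<open>(\<kappa>, \<kappa>)\<close>, and near it \<open>f\<close> increases.\<close>

lemma reflection_ordered_open:
  assumes cont: "continuous_on {r. 0 \<le> r \<and> ereal r \<le> R} f"
    and ord: "reflection_ordered R f \<kappa>"
    and strict: "\<And>r \<rho>. 0 \<le> r \<Longrightarrow> r < \<rho> \<Longrightarrow> ereal \<rho> \<le> R \<Longrightarrow> r + \<rho> = 2 * \<kappa> \<Longrightarrow> f r < f \<rho>"
    and d: "d > 0" and df: "\<And>x. \<bar>x - \<kappa>\<bar> < d \<Longrightarrow> (f has_real_derivative f1 x) (at x)"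
    and pos: "\<And>x. \<bar>x - \<kappa>\<bar> < d \<Longrightarrow> 0 < f1 x"
  shows "\<exists>\<epsilon>>0. reflection_ordered R f (\<kappa> - \<epsilon>)"
proof (rule ccontr)
  assume "\<not> ?thesis"
  then have "\<forall>n. \<not> reflection_ordered R f (\<kappa> - inverse (real (Suc n)))" by auto
  then have "\<forall>n. \<exists>z. 0 \<le> fst z \<and> fst z \<le> snd z \<and> ereal (snd z) \<le> R \<and>
      2 * (\<kappa> - inverse (real (Suc n))) \<le> fst z + snd z \<and> f (snd z) < f (fst z)"
    unfolding reflection_ordered_def by (simp add: not_le)
  then obtain z where z: "\<And>n. 0 \<le> fst (z n)" "\<And>n. fst (z n) \<le> snd (z n)"
      "\<And>n. ereal (snd (z n)) \<le> R"
      "\<And>n. 2 * (\<kappa> - inverse (real (Suc n))) \<le> fst (z n) + snd (z n)"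
      "\<And>n. f (snd (z n)) < f (fst (z n))"
    by metis
  \<comment> \<open>The order at \<open>\<kappa>\<close> keeps the violating pairs bounded even when
    \<open>R\<close> is infinite.\<close>
  have z2: "fst (z n) + snd (z n) < 2 * \<kappa>" for n
    using reflection_orderedD[OF ord z(1)[of n] z(2)[of n] z(3)[of n]] z(5)[of n] by linarith
  have "z n \<in> {0..2*\<kappa>} \<times> {0..2*\<kappa>}" for n
    using z(1)[of n] z(2)[of n] z2[of n] by (cases "z n") auto
  moreover have "compact ({0..2*\<kappa>} \<times> {0..2*\<kappa>})" by (intro compact_Times) auto
  ultimately obtain l s where s: "strict_mono s" "(z \<circ> s) \<longlonglongrightarrow> l"
    unfolding compact_def by metis
  define r where "r = fst l"
  define \<rho> where "\<rho> = snd l"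
  have lim_r: "(\<lambda>n. fst (z (s n))) \<longlonglongrightarrow> r" and lim_\<rho>: "(\<lambda>n. snd (z (s n))) \<longlonglongrightarrow> \<rho>"
    using tendsto_fst[OF s(2)] tendsto_snd[OF s(2)] by (simp_all add: r_def \<rho>_def o_def)
  have r0: "0 \<le> r" using LIMSEQ_le_const[OF lim_r] z(1) by blast
  have r\<rho>: "r \<le> \<rho>" using LIMSEQ_le[OF lim_r lim_\<rho>] z(2) by blast
  have "(\<lambda>n. ereal (snd (z (s n)))) \<longlonglongrightarrow> ereal \<rho>" using lim_\<rho> by simp
  then have \<rho>R: "ereal \<rho> \<le> R" using LIMSEQ_le_const2 z(3) by blast
  have in_dom: "r \<in> {r. 0 \<le> r \<and> ereal r \<le> R}" "\<rho> \<in> {r. 0 \<le> r \<and> ereal r \<le> R}"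
    using r0 r\<rho> \<rho>R by (auto intro: order_trans[of _ "ereal \<rho>"])
  have dom: "fst (z n) \<in> {r. 0 \<le> r \<and> ereal r \<le> R}" "snd (z n) \<in> {r. 0 \<le> r \<and> ereal r \<le> R}" for n
    using z(1)[of n] z(2)[of n] z(3)[of n] by (auto intro: order_trans[of _ "ereal (snd (z n))"])
  have "(\<lambda>n. f (fst (z (s n)))) \<longlonglongrightarrow> f r" "(\<lambda>n. f (snd (z (s n)))) \<longlonglongrightarrow> f \<rho>"
    using continuous_on_tendsto_compose[OF cont lim_r in_dom(1)]
      continuous_on_tendsto_compose[OF cont lim_\<rho> in_dom(2)] dom by auto
  then have fle: "f \<rho> \<le> f r" using LIMSEQ_le z(5) less_imp_le by blast
  have sum: "(\<lambda>n. fst (z (s n)) + snd (z (s n))) \<longlonglongrightarrow> r + \<rho>"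
    by (intro tendsto_add lim_r lim_\<rho>)
  have "(\<lambda>n. 2 * (\<kappa> - inverse (real (Suc (s n))))) \<longlonglongrightarrow> 2 * (\<kappa> - 0)"
    by (intro tendsto_intros LIMSEQ_subseq_LIMSEQ[OF LIMSEQ_inverse_real_of_nat s(1), unfolded o_def])
  then have "2 * (\<kappa> - 0) \<le> r + \<rho>" using LIMSEQ_le[OF _ sum] z(4) by blast
  moreover have "r + \<rho> \<le> 2 * \<kappa>" using LIMSEQ_le_const2[OF sum] z2 less_imp_le by blast
  ultimately have "r + \<rho> = 2 * \<kappa>" by simp
  then have "r = \<rho>" using strict[OF r0 _ \<rho>R] r\<rho> fle by fastforce
  then have eq: "r = \<kappa>" "\<rho> = \<kappa>" using \<open>r + \<rho> = 2 * \<kappa>\<close> by auto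
  have "eventually (\<lambda>n. dist (fst (z (s n))) \<kappa> < d) sequentially"
       "eventually (\<lambda>n. dist (snd (z (s n))) \<kappa> < d) sequentially"
    using tendstoD[OF lim_r d] tendstoD[OF lim_\<rho> d] eq by auto
  then have "eventually (\<lambda>n. dist (fst (z (s n))) \<kappa> < d \<and> dist (snd (z (s n))) \<kappa> < d) sequentially"
    by eventually_elim simp
  then obtain n where n: "dist (fst (z (s n))) \<kappa> < d" "dist (snd (z (s n))) \<kappa> < d"
    by (auto simp: eventually_sequentially)
  have "fst (z (s n)) < snd (z (s n))"
    using z(2)[of "s n"] z(5)[of "s n"] by (cases "fst (z (s n)) = snd (z (s n))") auto
  then have "f (fst (z (s n))) < f (snd (z (s n)))"
  proof (rule DERIV_pos_imp_increasing)
    fix x assume "fst (z (s n)) \<le> x" "x \<le> snd (z (s n))"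
    then have "\<bar>x - \<kappa>\<bar> < d" using n by (auto simp: dist_real_def abs_less_iff)
    then show "\<exists>y. DERIV f x :> y \<and> 0 < y" using df pos by blast
  qed
  with z(5)[of "s n"] show False by simp
qed

lemma reflection_ordered_deriv_nonneg:
  assumes ord: "reflection_ordered R f \<kappa>" and x: "0 < x" "\<kappa> \<le> x" "ereal x < R"
    and df: "(f has_real_derivative D) (at x)"
  shows "0 \<le> D"
proof (rule ccontr)
  assume "\<not> 0 \<le> D"
  then obtain e where e: "e > 0" "\<And>h. h > 0 \<Longrightarrow> h < e \<Longrightarrow> f (x + h) < f x"
    using has_real_derivative_neg_dec_right[OF df] by auto
  obtain y where "ereal x < ereal y" "ereal y < R" using ereal_dense2[OF x(3)] by blast
  then have y: "x < y" "ereal y < R" by auto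
  define h where "h = min (y - x) (e / 2)"
  have h: "0 < h" "h < e" "x + h \<le> y" using y e(1) by (auto simp: h_def)
  have "ereal (x + h) \<le> R" using h(3) y(2) by (metis ereal_less_eq(3) le_less_trans less_imp_le)
  then have "f x \<le> f (x + h)"
    by (intro reflection_orderedD[OF ord]) (use x h in auto)
  with e(2)[OF h(1,2)] show False by simp
qed

lemma obtain_radius:
  assumes "0 < x" "ereal x < R"
  obtains d where "0 < d" "\<And>y. \<bar>y - x\<bar> < d \<Longrightarrow> 0 < y \<and> ereal y < R"
proof -
  obtain z where "ereal x < ereal z" "ereal z < R" using ereal_dense2[OF assms(2)] by blast
  then have z: "x < z" "ereal z < R" by auto
  show thesis
  proof (rule that[of "min x (z - x)"])
    show "0 < y \<and> ereal y < R" if "\<bar>y - x\<bar> < min x (z - x)" for y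
      using that z(2) by (auto simp: abs_less_iff intro: le_less_trans[of _ "ereal z"])
  qed (use z assms in auto)
qed

text \<open>A substitute for Hopf's lemma at the mirror. From \<open>\<kappa>\<close> outward the
  slope is nonnegative, so a zero slope at \<open>\<kappa>\<close> makes the second derivative
  nonnegative; oddness of the difference handles the third.\<close>

lemma reflection_ordered_hopf:
  assumes ord: "reflection_ordered R f \<kappa>" and \<kappa>: "0 < \<kappa>" "ereal \<kappa> < R"
    and df: "\<And>r. 0 < r \<Longrightarrow> ereal r < R \<Longrightarrow> (f has_real_derivative f1 r) (at r)"
    and df1: "\<And>r. 0 < r \<Longrightarrow> ereal r < R \<Longrightarrow> (f1 has_real_derivative f2 r) (at r)"
    and df2: "(f2 has_real_derivative D) (at \<kappa>)"
    and le: "f1 \<kappa> \<le> 0"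
  shows "f1 \<kappa> = 0" "0 \<le> f2 \<kappa>" "0 \<le> D"
proof -
  show f1: "f1 \<kappa> = 0"
    using reflection_ordered_deriv_nonneg[OF ord \<kappa>(1) order_refl \<kappa>(2) df[OF \<kappa>]] le by simp
  obtain d where d: "0 < d" "\<And>y. \<bar>y - \<kappa>\<bar> < d \<Longrightarrow> 0 < y \<and> ereal y < R"
    using obtain_radius[OF \<kappa>] by blast
  show "0 \<le> D"
  proof (rule reflection_third_derivative[OF d(1) df df1 df2 f1])
    show "0 < y" "ereal y < R" "0 < y" "ereal y < R" if "\<bar>y - \<kappa>\<bar> < d" for y
      using d(2)[OF that] by auto
    fix h assume h: "0 < h" "h < d"
    then have "0 < \<kappa> - h" "ereal (\<kappa> + h) < R" using d(2)[of "\<kappa> - h"] d(2)[of "\<kappa> + h"] by auto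
    then show "f (\<kappa> - h) \<le> f (\<kappa> + h)"
      using h by (intro reflection_orderedD[OF ord]) auto
  qed
  show "0 \<le> f2 \<kappa>"
  proof (rule ccontr)
    assume "\<not> 0 \<le> f2 \<kappa>"
    then obtain e where e: "e > 0" "\<And>h. h > 0 \<Longrightarrow> h < e \<Longrightarrow> f1 (\<kappa> + h) < 0"
      using has_real_derivative_neg_dec_right[OF df1[OF \<kappa>]] f1 by auto
    define h where "h = min d e / 2"
    have h: "0 < h" "h < d" "h < e" using d(1) e(1) by (auto simp: h_def)
    have "0 < \<kappa> + h" "ereal (\<kappa> + h) < R" using d(2)[of "\<kappa> + h"] h by auto
    then have "0 \<le> f1 (\<kappa> + h)"
      using reflection_ordered_deriv_nonneg[OF ord _ _ _ df] h by auto
    with e(2)[OF h(1,3)] show False by simp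
  qed
qed

text \<open>Contact makes \<open>r\<close> a local minimum of
  \<open>f (2 * \<kappa> - y) - f y\<close>. Reflection flips the sign of the first derivative and
  keeps that of the second.\<close>

lemma reflection_ordered_touch:
  assumes ord: "reflection_ordered R f \<kappa>"
    and r: "0 < r" "r < \<rho>" "ereal \<rho> < R" "r + \<rho> = 2 * \<kappa>"
    and df: "\<And>r. 0 < r \<Longrightarrow> ereal r < R \<Longrightarrow> (f has_real_derivative f1 r) (at r)"
    and df1: "\<And>r. 0 < r \<Longrightarrow> ereal r < R \<Longrightarrow> (f1 has_real_derivative f2 r) (at r)"
    and eq: "f r = f \<rho>"
  shows "f1 r = - f1 \<rho>" "f2 r \<le> f2 \<rho>" "0 \<le> f1 \<rho>"
proof -
  have \<rho>: "0 < \<rho>" "\<kappa> < \<rho>" and rR: "ereal r < R" and \<rho>': "2 * \<kappa> - r = \<rho>"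
    using r by (auto intro: less_trans[of _ "ereal \<rho>"])
  obtain d where d: "0 < d" "\<And>y. \<bar>y - \<rho>\<bar> < d \<Longrightarrow> 0 < y \<and> ereal y < R"
    using obtain_radius[OF \<rho>(1) r(3)] by blast
  \<comment> \<open>Staying left of \<open>\<kappa>\<close> keeps \<open>y\<close> the inner point
    of its pair.\<close>
  define e where "e = min (min d r) (\<kappa> - r)"
  have e: "0 < e" using d r by (simp add: e_def)
  have dom: "0 < y" "y < \<kappa>" "ereal y < R" "0 < 2 * \<kappa> - y" "ereal (2 * \<kappa> - y) < R"
    if "\<bar>y - r\<bar> < e" for y
  proof -
    show "0 < y" "y < \<kappa>" using that by (auto simp: e_def abs_less_iff)
    then have "ereal y < ereal \<rho>" using \<rho> by simp
    then show "ereal y < R" using r(3) by (rule less_trans)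
    have "\<bar>(2 * \<kappa> - y) - \<rho>\<bar> < d" using that \<rho>' by (simp add: e_def abs_less_iff)
    then show "0 < 2 * \<kappa> - y" "ereal (2 * \<kappa> - y) < R" using d(2)[of "2 * \<kappa> - y"] by blast+
  qed
  define a where "a y = f (2 * \<kappa> - y) - f y" for y
  define a1 where "a1 y = f1 (2 * \<kappa> - y) * (- 1) - f1 y" for y
  have da: "(a has_real_derivative a1 y) (at y)" if "\<bar>y - r\<bar> < e" for y
    unfolding a_def a1_def
    by (intro DERIV_diff DERIV_chain2[of f] df dom[OF that]) (auto intro!: derivative_eq_intros)
  have "\<bar>r - r\<bar> < e" using e by simp
  note rr = dom[OF this]
  have da1: "(a1 has_real_derivative f2 (2 * \<kappa> - r) * (- 1) * (- 1) - f2 r) (at r)"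
    unfolding a1_def
    by (intro DERIV_diff DERIV_cmult_right DERIV_chain2[of f1] df1 rr) (auto intro!: derivative_eq_intros)
  have min: "a r \<le> a y" if "\<bar>y - r\<bar> < e" for y
    using reflection_orderedD[OF ord, of y "2 * \<kappa> - y"] dom[OF that] eq \<rho>'
    by (simp add: a_def)
  show "f1 r = - f1 \<rho>" "f2 r \<le> f2 \<rho>"
    using local_min_second_derivative[OF e da da1 min] \<rho>' by (auto simp: a1_def)
  show "0 \<le> f1 \<rho>"
    using reflection_ordered_deriv_nonneg[OF ord \<rho>(1) _ r(3) df] \<rho> r(3) by simp
qed

section \<open>The normalised system\<close>

text \<open>With \<open>\<beta> = b\<^sup>2 s\<^sub>+ / 3\<close>, \<open>\<gamma> = c\<^sup>2 s\<^sub>+\<^sup>2 / 6\<close> and the quadratic equation for \<open>s\<^sub>+\<close>, which reads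
  \<open>a\<^sup>2 = 4 \<gamma> - \<beta>\<close>, these are \<open>h\<close> and \<open>g\<close> in the variables \<open>U\<close>, \<open>V\<close>; the three cases of the
  theorem are \<open>\<beta> < 2 \<gamma>\<close>, \<open>\<beta> = 2 \<gamma>\<close> and \<open>\<beta> > 2 \<gamma>\<close>.\<close>

definition hn :: "real \<Rightarrow> real \<Rightarrow> real \<Rightarrow> real \<Rightarrow> real" where
  "hn \<beta> \<gamma> x y = x * (\<beta> - 4 * \<gamma> - \<beta> * y + \<gamma> * (3 * x^2 + y^2))"

definition gn :: "real \<Rightarrow> real \<Rightarrow> real \<Rightarrow> real \<Rightarrow> real" where
  "gn \<beta> \<gamma> x y = y * (\<beta> - 4 * \<gamma> + \<beta> / 2 * y + \<gamma> * (3 * x^2 + y^2)) - 3 * \<beta> / 2 * x^2"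

text \<open>Let \<open>2 q\<close> be the length of \<open>(sqrt 3 x, y)\<close>. Then
  \<open>y^3 - 9 x^2 y\<close> is \<open>8 q^3\<close> times the cosine of a triple angle, so at
  least \<open>- 8 q^3\<close>. The excess over this minimum is
  \<open>4 (y - q)^2 (y + 2 q)\<close>, and what remains factors through
  \<open>q - 1\<close>.\<close>

lemma radial_energy_nonneg:
  fixes \<beta> \<gamma> x y :: real
  assumes "0 < \<beta>" "0 < \<gamma>" "\<beta> \<le> 4 * \<gamma>" "0 \<le> y" "4 \<le> 3 * x^2 + y^2"
  shows "0 \<le> 3 * x * hn \<beta> \<gamma> x y + y * gn \<beta> \<gamma> x y"
proof -
  define q where "q = sqrt (3 * x^2 + y^2) / 2"
  have q2: "3 * x^2 = 4 * q^2 - y^2" by (simp add: q_def power_divide field_simps)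
  have "sqrt 4 \<le> sqrt (3 * x^2 + y^2)" using assms(5) by (simp only: real_sqrt_le_iff)
  then have q: "1 \<le> q" by (simp add: q_def)
  have "3 * x * hn \<beta> \<gamma> x y + y * gn \<beta> \<gamma> x y =
      (3*x^2 + y^2) * (\<beta> - 4*\<gamma> + \<gamma> * (3*x^2 + y^2)) + \<beta> / 2 * (y^3 - 3 * (3 * x^2) * y)"
    by (simp add: hn_def gn_def field_simps power2_eq_square power3_eq_cube)
  also have "\<dots> = 4*q^2 * (\<beta> - 4*\<gamma> + \<gamma> * (4*q^2)) + \<beta> / 2 * (y^3 - 3 * (4*q^2 - y^2) * y)"
    unfolding q2 by simp
  also have "\<dots> = 4*q^2 * ((q - 1) * (4*\<gamma>*(q + 1) - \<beta>)) + 2 * \<beta> * ((y - q)^2 * (y + 2*q))"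
    by (simp add: field_simps power2_eq_square power3_eq_cube)
  also have "0 \<le> \<dots>"
  proof -
    have "\<beta> \<le> 4*\<gamma>*(q + 1)" using assms(2,3) q by (simp add: distrib_left) (smt (verit) mult_nonneg_nonneg)
    then show ?thesis using q assms by simp
  qed
  finally show ?thesis .
qed

text \<open>\<open>gn\<close> is affine in \<open>x\<^sup>2\<close>, so its sign on the ellipse \<open>3 x\<^sup>2 + y\<^sup>2 \<le> 4\<close> is decided at \<open>x = 0\<close>
  and on the boundary.\<close>

lemma gn_affine:
  "gn \<beta> \<gamma> x y = y * (\<beta> - 4*\<gamma> + \<beta>/2 * y + \<gamma> * y^2) + x^2 * (3*\<gamma>*y - 3*\<beta>/2)"
  by (simp add: gn_def field_simps power2_eq_square)

text \<open>\<open>m\<close> stands for \<open>x^2\<close>, which avoids a square root for the point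
  of the ellipse at height \<open>y\<close>. On the ellipse the \<open>\<gamma>\<close> terms
  cancel.\<close>

lemma gn_boundary:
  fixes \<beta> \<gamma> m y :: real
  assumes "3 * m = 4 - y^2"
  shows "y * (\<beta> - 4*\<gamma> + \<beta>/2 * y + \<gamma> * y^2) + m * (3*\<gamma>*y - 3*\<beta>/2) = (y - 1) * (\<beta> * (y + 2))"
proof -
  have "y * (\<beta> - 4*\<gamma> + \<beta>/2 * y + \<gamma> * y^2) + m * (3*\<gamma>*y - 3*\<beta>/2)
      = y * (\<beta> - 4*\<gamma> + \<beta>/2 * y + \<gamma> * y^2) + (3 * m) * (\<gamma>*y - \<beta>/2)"
    by (simp add: field_simps)
  also have "\<dots> = (y - 1) * (\<beta> * (y + 2))"
    unfolding assms by (simp add: field_simps power2_eq_square)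
  finally show ?thesis .
qed

lemma gn_pos:
  fixes \<beta> \<gamma> x y :: real
  assumes "0 < \<beta>" "0 < \<gamma>" "2 * \<gamma> \<le> \<beta>" "1 < y" "3 * x^2 + y^2 \<le> 4"
  shows "0 < gn \<beta> \<gamma> x y"
proof -
  have "1 < y^2" using assms(4) by (simp add: one_less_power)
  then have "\<gamma> < \<gamma> * y^2" "\<beta> / 2 < \<beta>/2 * y" using assms by simp_all
  then have "0 < \<beta> - 4*\<gamma> + \<beta>/2 * y + \<gamma> * y^2" using assms(3) by linarith
  then have A: "0 < y * (\<beta> - 4*\<gamma> + \<beta>/2 * y + \<gamma> * y^2)" using assms(4) by simp
  \<comment> \<open>The largest admissible \<open>x^2\<close>; the sign of the slope in
    \<open>x^2\<close> tells whether 0 or \<open>m\<close> is the worst case.\<close>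
  define m where "m = (4 - y^2) / 3"
  have m: "3 * m = 4 - y^2" "x^2 \<le> m" using assms(5) by (auto simp: m_def)
  have B: "0 < (y - 1) * (\<beta> * (y + 2))" using assms by simp
  show ?thesis
  proof (cases "0 \<le> 3*\<gamma>*y - 3*\<beta>/2")
    case True
    then have "0 \<le> x^2 * (3*\<gamma>*y - 3*\<beta>/2)" by simp
    then show ?thesis unfolding gn_affine using A by linarith
  next
    case False
    then have "m * (3*\<gamma>*y - 3*\<beta>/2) \<le> x^2 * (3*\<gamma>*y - 3*\<beta>/2)"
      using m(2) by (intro mult_right_mono_neg) auto
    then show ?thesis unfolding gn_affine using B gn_boundary[OF m(1), of \<beta> \<gamma>] by linarith
  qed
qed

lemma gn_neg:
  fixes \<beta> \<gamma> x y :: real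
  assumes "0 < \<beta>" "0 < \<gamma>" "\<beta> \<le> 2 * \<gamma>" "0 < y" "y < 1" "3 * x^2 + y^2 \<le> 4"
  shows "gn \<beta> \<gamma> x y < 0"
proof -
  have "y^2 < 1" using assms(4,5) by (simp add: power_less_one_iff)
  then have "\<gamma> * y^2 < \<gamma>" "\<beta>/2 * y < \<beta> / 2" using assms by simp_all
  then have "\<beta> - 4*\<gamma> + \<beta>/2 * y + \<gamma> * y^2 < 0" using assms(3) by linarith
  then have A: "y * (\<beta> - 4*\<gamma> + \<beta>/2 * y + \<gamma> * y^2) < 0"
    using assms(4) by (simp add: mult_pos_neg)
  define m where "m = (4 - y^2) / 3"
  have m: "3 * m = 4 - y^2" "x^2 \<le> m" using assms(6) by (auto simp: m_def)
  have B: "(y - 1) * (\<beta> * (y + 2)) < 0" using assms by (intro mult_neg_pos) auto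
  show ?thesis
  proof (cases "0 \<le> 3*\<gamma>*y - 3*\<beta>/2")
    case True
    then have "x^2 * (3*\<gamma>*y - 3*\<beta>/2) \<le> m * (3*\<gamma>*y - 3*\<beta>/2)"
      using m(2) by (intro mult_right_mono) auto
    then show ?thesis unfolding gn_affine using B gn_boundary[OF m(1), of \<beta> \<gamma>] by linarith
  next
    case False
    then have "x^2 * (3*\<gamma>*y - 3*\<beta>/2) \<le> 0" by (intro mult_nonneg_nonpos) auto
    then show ?thesis unfolding gn_affine using A by linarith
  qed
qed

text \<open>Arranged around the equilibrium \<open>(1, 1)\<close>: on the line \<open>y = 1\<close>
  only \<open>3 \<gamma> x (x^2 - 1)\<close> is left.\<close>

lemma hn_factor:
  "hn \<beta> \<gamma> x y = x * (3 * \<gamma> * (x^2 - 1) + (1 - y) * (\<beta> - \<gamma> * (y + 1)))"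
  by (simp add: hn_def field_simps power2_eq_square)

text \<open>The sign \<open>\<sigma>\<close> is chosen so that \<open>\<sigma> V\<close> is the component expected to increase; for
  \<open>\<beta> = 2 \<gamma>\<close> both signs are admissible.\<close>

locale radial_profile =
  fixes \<beta> \<gamma> K :: real and R :: ereal and U U1 U2 V V1 V2 :: "real \<Rightarrow> real" and \<sigma> :: real
  assumes \<beta>: "0 < \<beta>" and \<gamma>: "0 < \<gamma>" and \<beta>_le: "\<beta> \<le> 4 * \<gamma>" and K: "0 < K" and R: "0 < R"
    and sign: "\<sigma> = 1 \<or> \<sigma> = - 1" and sign_param: "0 \<le> \<sigma> * (\<beta> - 2 * \<gamma>)"
    and dU: "\<And>r. 0 < r \<Longrightarrow> ereal r < R \<Longrightarrow> (U has_real_derivative U1 r) (at r)"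
    and dU1: "\<And>r. 0 < r \<Longrightarrow> ereal r < R \<Longrightarrow> (U1 has_real_derivative U2 r) (at r)"
    and dV: "\<And>r. 0 < r \<Longrightarrow> ereal r < R \<Longrightarrow> (V has_real_derivative V1 r) (at r)"
    and dV1: "\<And>r. 0 < r \<Longrightarrow> ereal r < R \<Longrightarrow> (V1 has_real_derivative V2 r) (at r)"
    and U_eq: "\<And>r. 0 < r \<Longrightarrow> ereal r < R \<Longrightarrow>
      U2 r = K * U r / r^2 + hn \<beta> \<gamma> (U r) (V r) - U1 r / r"
    and V_eq: "\<And>r. 0 < r \<Longrightarrow> ereal r < R \<Longrightarrow> V2 r = gn \<beta> \<gamma> (U r) (V r) - V1 r / r"
    and U_cont: "continuous_on {r. 0 \<le> r \<and> ereal r \<le> R} U"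
    and V_cont: "continuous_on {r. 0 \<le> r \<and> ereal r \<le> R} V"
    and U_0: "U 0 = 0" and V1_0: "(V1 \<longlongrightarrow> 0) (at_right 0)"
    and U_lim: "(U \<longlongrightarrow> 1) (end_filter R)" and V_lim: "(V \<longlongrightarrow> 1) (end_filter R)"
    and U_end: "\<And>r. ereal r = R \<Longrightarrow> U r = 1" and V_end: "\<And>r. ereal r = R \<Longrightarrow> V r = 1"
    and U_pos: "\<And>r. 0 < r \<Longrightarrow> ereal r < R \<Longrightarrow> 0 < U r"
    and V_pos: "\<And>r. 0 < r \<Longrightarrow> ereal r < R \<Longrightarrow> 0 < V r"
begin

section \<open>A priori bounds on the profile\<close>

lemma sign_sq [simp]: "\<sigma> * \<sigma> = 1" "\<sigma> * (\<sigma> * x) = x" using sign by auto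

lemma less_R: "x \<le> y \<Longrightarrow> ereal y < R \<Longrightarrow> ereal x < R"
  by (meson ereal_less_eq(3) le_less_trans)

lemma obtain_pos:
  obtains z where "0 < z" "ereal z < R"
proof -
  have "ereal 0 < R" using R by (simp add: zero_ereal_def)
  then obtain z where "ereal 0 < ereal z" "ereal z < R" using ereal_dense2 by blast
  then show thesis by (intro that[of z]) auto
qed

lemma tendsto_at_0:
  assumes "continuous_on {r. 0 \<le> r \<and> ereal r \<le> R} f"
  shows "(f \<longlongrightarrow> f 0) (at_right 0)"
proof -
  obtain z where z: "0 < z" "ereal z < R" using obtain_pos by blast
  have "continuous_on {0..z} f"
    by (rule continuous_on_subset[OF assms])
      (use z less_R[of _ z] in \<open>auto intro: less_imp_le\<close>)
  then show ?thesis using continuous_on_Icc_at_rightD[of 0 z f] z by simp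
qed

lemmas U_at_0 = tendsto_at_0[OF U_cont, unfolded U_0] and V_at_0 = tendsto_at_0[OF V_cont]

lemma norm_bound:
  assumes "0 < r" "ereal r < R"
  shows "3 * (U r)^2 + (V r)^2 \<le> 4"
proof (rule radial_max_principle[where f = "\<lambda>r. 3 * (U r)^2 + (V r)^2" and R = R])
  show "((\<lambda>r. 3 * (U r)^2 + (V r)^2) has_real_derivative 6 * U r * U1 r + 2 * V r * V1 r) (at r)"
    if "0 < r" "ereal r < R" for r
    by (auto intro!: derivative_eq_intros dU dV that)
  show "((\<lambda>r. 6 * U r * U1 r + 2 * V r * V1 r) has_real_derivative
      6 * (U1 r)^2 + 6 * U r * U2 r + 2 * (V1 r)^2 + 2 * V r * V2 r) (at r)"
    if "0 < r" "ereal r < R" for r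
    by (auto intro!: derivative_eq_intros dU dV dU1 dV1 that simp: power2_eq_square)
  have "((\<lambda>r. 3 * (U r)^2 + (V r)^2) \<longlongrightarrow> 3 * 0^2 + (V 0)^2) (at_right 0)"
    by (intro tendsto_intros U_at_0 V_at_0)
  then have "eventually (\<lambda>r. 3 * (U r)^2 + (V r)^2 < (V 0)^2 + 1) (at_right 0)"
    by (rule order_tendstoD) simp
  then show "eventually (\<lambda>r. 3 * (U r)^2 + (V r)^2 \<le> (V 0)^2 + 1) (at_right 0)"
    by eventually_elim simp
  show "((\<lambda>r. 3 * (U r)^2 + (V r)^2) \<longlongrightarrow> 3 * 1^2 + 1^2) (end_filter R)"
    by (intro tendsto_intros U_lim V_lim)
  show "0 < 6 * (U1 r)^2 + 6 * U r * U2 r + 2 * (V1 r)^2 + 2 * V r * V2 r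
      + (6 * U r * U1 r + 2 * V r * V1 r) / r"
    if r: "0 < r" "ereal r < R" and gt: "4 < 3 * (U r)^2 + (V r)^2" for r
  proof -
    have eq: "6 * (U1 r)^2 + 6 * U r * U2 r + 2 * (V1 r)^2 + 2 * V r * V2 r
      + (6 * U r * U1 r + 2 * V r * V1 r) / r
      = 6 * (U1 r)^2 + 2 * (V1 r)^2 + 6 * K * (U r)^2 / r^2 +
        2 * (3 * U r * hn \<beta> \<gamma> (U r) (V r) + V r * gn \<beta> \<gamma> (U r) (V r))"
      using r by (simp add: U_eq V_eq field_simps power2_eq_square)
    \<comment> \<open>\<open>radial_energy_nonneg\<close> gives a weak inequality; the centrifugal
      term \<open>K U^2 / r^2\<close> makes it strict.\<close>
    have pos: "0 < 6 * K * (U r)^2 / r^2" using r K U_pos[OF r] by simp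
    have nonneg: "0 \<le> 3 * U r * hn \<beta> \<gamma> (U r) (V r) + V r * gn \<beta> \<gamma> (U r) (V r)"
      using radial_energy_nonneg[OF \<beta> \<gamma> \<beta>_le, of "V r" "U r"] V_pos[OF r] gt by simp
    show ?thesis
      unfolding eq by (intro add_pos_nonneg add_nonneg_pos pos mult_nonneg_nonneg nonneg) auto
  qed
qed (use assms in auto)

lemma V_sign_le:
  assumes "0 < r" "ereal r < R"
  shows "\<sigma> * V r \<le> \<sigma>"
proof (rule radial_max_principle[where f = "\<lambda>r. \<sigma> * V r" and R = R])
  show "((\<lambda>r. \<sigma> * V r) has_real_derivative \<sigma> * V1 r) (at r)"
    if "0 < r" "ereal r < R" for r by (rule DERIV_cmult dV that)+
  show "((\<lambda>r. \<sigma> * V1 r) has_real_derivative \<sigma> * V2 r) (at r)"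
    if "0 < r" "ereal r < R" for r by (rule DERIV_cmult dV1 that)+
  have "((\<lambda>r. \<sigma> * V r) \<longlongrightarrow> \<sigma> * V 0) (at_right 0)" by (intro tendsto_intros V_at_0)
  then have "eventually (\<lambda>r. \<sigma> * V r < \<sigma> * V 0 + 1) (at_right 0)"
    by (rule order_tendstoD) simp
  then show "eventually (\<lambda>r. \<sigma> * V r \<le> \<sigma> * V 0 + 1) (at_right 0)" by eventually_elim simp
  show "((\<lambda>r. \<sigma> * V r) \<longlongrightarrow> \<sigma> * 1) (end_filter R)" by (intro tendsto_intros V_lim)
  show "0 < \<sigma> * V2 r + \<sigma> * V1 r / r" if r: "0 < r" "ereal r < R" and gt: "\<sigma> < \<sigma> * V r" for r
  proof -
    have "\<sigma> * V2 r + \<sigma> * V1 r / r = \<sigma> * gn \<beta> \<gamma> (U r) (V r)"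
      using r by (simp add: V_eq algebra_simps)
    also have "0 < \<dots>"
      using sign
    proof
      assume "\<sigma> = 1"
      then show ?thesis using gn_pos[OF \<beta> \<gamma> _ _ norm_bound[OF r]] gt sign_param by simp
    next
      assume "\<sigma> = - 1"
      then show ?thesis using gn_neg[OF \<beta> \<gamma> _ V_pos[OF r] _ norm_bound[OF r]] gt sign_param by simp
    qed
    finally show ?thesis .
  qed
qed (use assms in auto)

lemma V_sign_le_0: "\<sigma> * V 0 \<le> \<sigma>"
proof -
  obtain z where z: "0 < z" "ereal z < R" using obtain_pos by blast
  have "((\<lambda>r. \<sigma> * V r) \<longlongrightarrow> \<sigma> * V 0) (at_right 0)" by (intro tendsto_intros V_at_0)
  moreover have "eventually (\<lambda>r. \<sigma> * V r \<le> \<sigma>) (at_right 0)"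
    using z by (auto simp: eventually_at_right_field intro!: exI[of _ z] V_sign_le less_R[of _ z])
  ultimately show ?thesis using tendsto_upperbound trivial_limit_at_right_real by blast
qed

text \<open>After subtracting the value at \<open>y = z = 1\<close>, what remains is
  \<open>\<gamma>\<close> times the two distances to the bound. Up to the factor \<open>- x\<close>,
  \<open>\<beta> - \<gamma> * (y + z)\<close> is the difference quotient of \<open>hn\<close> in its
  second argument.\<close>

lemma sign_coupling: "\<sigma> * y \<le> \<sigma> \<Longrightarrow> \<sigma> * z \<le> \<sigma> \<Longrightarrow> 0 \<le> \<sigma> * (\<beta> - \<gamma> * (y + z))"
proof -
  assume "\<sigma> * y \<le> \<sigma>" "\<sigma> * z \<le> \<sigma>"
  then have "0 \<le> \<gamma> * (2 * \<sigma> - \<sigma> * y - \<sigma> * z)" using \<gamma> by simp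
  then show ?thesis using sign_param by (simp add: algebra_simps)
qed

lemma hn_antimono:
  assumes "0 \<le> x" "\<sigma> * y \<le> \<sigma> * z" "\<sigma> * z \<le> \<sigma>"
  shows "hn \<beta> \<gamma> x z \<le> hn \<beta> \<gamma> x y"
proof -
  have "hn \<beta> \<gamma> x y - hn \<beta> \<gamma> x z = (\<sigma> * \<sigma>) * (x * ((z - y) * (\<beta> - \<gamma> * (y + z))))"
    unfolding sign_sq by (simp add: hn_def algebra_simps power2_eq_square)
  also have "\<dots> = x * ((\<sigma> * z - \<sigma> * y) * (\<sigma> * (\<beta> - \<gamma> * (y + z))))"
    by (simp add: algebra_simps)
  also have "\<dots> \<ge> 0" using assms sign_coupling[of y z] by simp
  finally show ?thesis by simp
qed

lemma gn_diff:
  "\<sigma> * gn \<beta> \<gamma> x y - \<sigma> * gn \<beta> \<gamma> x' y = 3/2 * (x'^2 - x^2) * (\<sigma> * (\<beta> - \<gamma> * (y + y)))"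
  by (simp add: gn_def algebra_simps power2_eq_square)

lemma sign_param_pos: "\<beta> \<noteq> 2 * \<gamma> \<Longrightarrow> 0 < \<sigma> * (\<beta> - 2 * \<gamma>)"
  using sign_param sign by (auto simp: less_le)

lemma sign_coupling_strict:
  assumes "\<beta> \<noteq> 2 * \<gamma>" "\<sigma> * y \<le> \<sigma>"
  shows "0 < \<sigma> * (\<beta> - \<gamma> * (y + y))"
proof -
  have "0 \<le> \<gamma> * (2 * \<sigma> - \<sigma> * y - \<sigma> * y)" using \<gamma> assms by simp
  then show ?thesis using sign_param_pos[OF assms(1)] by (simp add: algebra_simps)
qed

lemma gn_antimono_strict:
  assumes "\<beta> \<noteq> 2 * \<gamma>" "0 \<le> x" "x < x'" "\<sigma> * y \<le> \<sigma>"
  shows "\<sigma> * gn \<beta> \<gamma> x' y < \<sigma> * gn \<beta> \<gamma> x y"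
proof -
  have "x^2 < x'^2" using assms by (intro power_strict_mono) auto
  then have "0 < 3/2 * (x'^2 - x^2) * (\<sigma> * (\<beta> - \<gamma> * (y + y)))"
    using sign_coupling_strict[OF assms(1,4)] by simp
  then show ?thesis using gn_diff[of x y x'] by simp
qed

lemma gn_1_1: "gn \<beta> \<gamma> 1 1 = 0" by (simp add: gn_def)

lemma hn_1_1: "hn \<beta> \<gamma> 1 1 = 0" by (simp add: hn_def)

text \<open>Raising \<open>\<sigma> y\<close> to its bound can only lower \<open>hn\<close>, so
  \<open>y = 1\<close> is the worst case.\<close>

lemma hn_nonneg:
  assumes "1 \<le> x" "\<sigma> * y \<le> \<sigma>"
  shows "0 \<le> hn \<beta> \<gamma> x y"
proof -
  have "hn \<beta> \<gamma> x 1 \<le> hn \<beta> \<gamma> x y" using assms by (intro hn_antimono) auto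
  moreover have "0 \<le> hn \<beta> \<gamma> x 1"
    using assms \<gamma> by (simp add: hn_factor)
  ultimately show ?thesis by simp
qed

lemma U_le_1:
  assumes "0 < r" "ereal r < R"
  shows "U r \<le> 1"
proof (rule radial_max_principle[OF dU dU1 _ U_lim])
  have "eventually (\<lambda>r. U r < 1) (at_right 0)" by (rule order_tendstoD(2)[OF U_at_0]) simp
  then show "eventually (\<lambda>r. U r \<le> 1) (at_right 0)" by eventually_elim simp
  show "0 < U2 r + U1 r / r" if r: "0 < r" "ereal r < R" and gt: "1 < U r" for r
  proof -
    have "0 < K * U r / r^2" using r K U_pos by simp
    then show ?thesis using U_eq[OF r] hn_nonneg[of "U r" "V r"] gt V_sign_le[OF r] by simp
  qed
qed (use assms in auto)

text \<open>At a contact with 1 the term \<open>K U / r^2\<close> would make \<open>U2\<close>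
  positive at a maximum of \<open>U\<close>.\<close>

lemma U_less_1:
  assumes r: "0 < r" "ereal r < R"
  shows "U r < 1"
proof (rule ccontr)
  assume "\<not> U r < 1"
  then have eq: "U r = 1" using U_le_1[OF r] by simp
  obtain d where d: "0 < d" "\<And>y. \<bar>y - r\<bar> < d \<Longrightarrow> 0 < y \<and> ereal y < R"
    using obtain_radius[OF r] by blast
  have "- U1 r = 0" "0 \<le> - U2 r"
    using local_min_second_derivative[OF d(1) DERIV_minus[OF dU] DERIV_minus[OF dU1[OF r]]]
      d(2) U_le_1 eq by auto
  moreover have "0 < K * U r / r^2" using r K U_pos by simp
  ultimately show False
    using U_eq[OF r] hn_nonneg[of "U r" "V r"] eq V_sign_le[OF r] by simp
qed

text \<open>At a contact, \<open>U < 1\<close> makes \<open>\<sigma> gn\<close> strictly larger than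
  its value 0 at \<open>(1, 1)\<close>, against a maximum of \<open>\<sigma> V\<close>.\<close>

lemma V_sign_less:
  assumes ne: "\<beta> \<noteq> 2 * \<gamma>" and r: "0 < r" "ereal r < R"
  shows "\<sigma> * V r < \<sigma>"
proof (rule ccontr)
  assume "\<not> \<sigma> * V r < \<sigma>"
  then have eq: "\<sigma> * V r = \<sigma>" using V_sign_le[OF r] by simp
  then have "V r = 1" using sign by auto
  obtain d where d: "0 < d" "\<And>y. \<bar>y - r\<bar> < d \<Longrightarrow> 0 < y \<and> ereal y < R"
    using obtain_radius[OF r] by blast
  have "- (\<sigma> * V1 r) = 0" "0 \<le> - (\<sigma> * V2 r)"
    using local_min_second_derivative[OF d(1) DERIV_minus[OF DERIV_cmult[OF dV]]
        DERIV_minus[OF DERIV_cmult[OF dV1[OF r]]], of \<sigma>] d(2) V_sign_le eq by auto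
  moreover have "\<sigma> * gn \<beta> \<gamma> 1 (V r) < \<sigma> * gn \<beta> \<gamma> (U r) (V r)"
    using gn_antimono_strict[OF ne _ U_less_1[OF r], of "V r"] U_pos[OF r] eq by simp
  ultimately show False using V_eq[OF r] \<open>V r = 1\<close> sign by (auto simp: gn_1_1)
qed

text \<open>The centre is not an interior point, so the equation is used in the form
  \<open>(r V')' = r gn\<close>. If \<open>\<sigma> V 0\<close> attained the bound,
  \<open>U 0 = 0\<close> would make \<open>\<sigma> gn\<close> positive near 0, and
  \<open>\<sigma> V\<close> would rise beyond the bound.\<close>

lemma V_sign_less_0:
  assumes ne: "\<beta> \<noteq> 2 * \<gamma>"
  shows "\<sigma> * V 0 < \<sigma>"
proof (rule ccontr)
  assume "\<not> \<sigma> * V 0 < \<sigma>"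
  then have eq: "\<sigma> * V 0 = \<sigma>" using V_sign_le_0 by simp
  then have V0: "V 0 = 1" using sign by auto
  have "((\<lambda>r. \<sigma> * gn \<beta> \<gamma> (U r) (V r)) \<longlongrightarrow> \<sigma> * gn \<beta> \<gamma> 0 (V 0)) (at_right 0)"
    unfolding gn_def by (intro tendsto_intros U_at_0 V_at_0)
  moreover have "0 < \<sigma> * gn \<beta> \<gamma> 0 (V 0)"
    using gn_antimono_strict[OF ne, of 0 1 "V 0"] eq by (simp add: V0 gn_1_1)
  ultimately have ev: "eventually (\<lambda>r. 0 < \<sigma> * gn \<beta> \<gamma> (U r) (V r)) (at_right 0)"
    by (rule order_tendstoD)
  obtain z where z: "0 < z" "ereal z < R" using obtain_pos by blast
  obtain d where d: "0 < d" "\<And>r. 0 < r \<Longrightarrow> r < d \<Longrightarrow> 0 < \<sigma> * gn \<beta> \<gamma> (U r) (V r)"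
    using ev by (auto simp: eventually_at_right_field)
  define b where "b = min z d / 2"
  have b: "0 < b" "b < d" "ereal b < R" using z d by (auto simp: b_def intro!: less_R[of _ z])
  \<comment> \<open>The factor \<open>r\<close> absorbs the drift term; by \<open>V1_0\<close> the
    product vanishes continuously at 0.\<close>
  define g where "g r = r * (\<sigma> * V1 r)" for r
  have dg: "(g has_real_derivative r * (\<sigma> * gn \<beta> \<gamma> (U r) (V r))) (at r)" if "0 < r" "r \<le> b" for r
  proof -
    have r: "0 < r" "ereal r < R" using that b less_R by auto
    show ?thesis unfolding g_def
      using r by (auto intro!: derivative_eq_intros dV1 simp: V_eq field_simps)
  qed
  have V1pos: "0 < \<sigma> * V1 r" if "0 < r" "r \<le> b" for r
  proof -
    have "g 0 < g r"
    proof (rule DERIV_pos_imp_increasing_open[OF that(1)])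
      show "\<exists>y. DERIV g x :> y \<and> 0 < y" if "0 < x" "x < r" for x
        using dg[of x] d(2)[of x] that \<open>r \<le> b\<close> b by auto
      show "continuous_on {0..r} g"
      proof (rule continuous_on_IccI[OF _ _ _ that(1)])
        have "(g \<longlongrightarrow> 0 * (\<sigma> * 0)) (at_right 0)"
          unfolding g_def by (intro tendsto_intros V1_0)
        then show "(g \<longlongrightarrow> g 0) (at_right 0)" by (simp add: g_def)
        have *: "(g \<longlongrightarrow> g x) (at x)" if "0 < x" "x \<le> r" for x
          using dg[of x] that \<open>r \<le> b\<close> by (auto dest: DERIV_isCont simp: isCont_def)
        show "(g \<longlongrightarrow> g r) (at_left r)"
          using *[OF that(1) order_refl] by (simp add: filterlim_at_split)
        show "g \<midarrow>x\<rightarrow> g x" if "0 < x" "x < r" for x using * that by simp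
      qed
    qed
    then show ?thesis using that by (simp add: g_def zero_less_mult_iff)
  qed
  have "\<sigma> * V 0 < \<sigma> * V b"
  proof (rule DERIV_pos_imp_increasing_open[OF b(1)])
    show "continuous_on {0..b} (\<lambda>r. \<sigma> * V r)"
      by (intro continuous_intros continuous_on_subset[OF V_cont])
        (use b less_R[of _ b] in \<open>auto intro: less_imp_le\<close>)
    show "\<exists>y. DERIV (\<lambda>r. \<sigma> * V r) x :> y \<and> 0 < y" if "0 < x" "x < b" for x
      using DERIV_cmult[OF dV, of x \<sigma>] V1pos[of x] that less_R[of x b] b by auto
  qed
  then show False using V_sign_le[OF b(1,3)] eq by simp
qed

end

section \<open>Asymptotics and comparison at the outer end\<close>

lemma limit_le_of_deriv_nonpos:
  fixes f f1 :: "real \<Rightarrow> real"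
  assumes lim: "(f \<longlongrightarrow> L) (end_filter R)" and r: "0 < r" "ereal r < R"
    and df: "\<And>x. r \<le> x \<Longrightarrow> ereal x < R \<Longrightarrow> (f has_real_derivative f1 x) (at x)"
    and neg: "\<And>x. r \<le> x \<Longrightarrow> ereal x < R \<Longrightarrow> f1 x \<le> 0"
  shows "L \<le> f r"
proof -
  have R: "0 < R" using r by (metis ereal_less(2) less_trans)
  have "f x \<le> f r" if x: "r < x" "ereal x < R" for x
  proof (rule DERIV_nonpos_imp_nonincreasing[where f = f])
    show "\<exists>D. DERIV f z :> D \<and> D \<le> 0" if z: "r \<le> z" "z \<le> x" for z
    proof -
      have "ereal z < R" using z x by (meson ereal_less_eq(3) le_less_trans)
      then show ?thesis using df neg z by blast
    qed
  qed (use x in simp)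
  then have "eventually (\<lambda>x. f x \<le> f r) (end_filter R)"
    unfolding eventually_end_filter[OF R] using r by blast
  then show ?thesis using tendsto_upperbound[OF lim] end_filter_neq_bot[OF R] by blast
qed

text \<open>Convergence of \<open>f\<close> yields a point of small slope in every far unit
  interval. Along that interval \<open>(r f')' = r (f'' + f'/r)\<close> is small relative to
  \<open>r\<close>, so the small slope carries back to the left end.\<close>

lemma radial_deriv_tendsto_0:
  fixes f f1 f2 :: "real \<Rightarrow> real"
  assumes df: "\<And>r. 0 < r \<Longrightarrow> (f has_real_derivative f1 r) (at r)"
    and df1: "\<And>r. 0 < r \<Longrightarrow> (f1 has_real_derivative f2 r) (at r)"
    and lim: "(f \<longlongrightarrow> L) at_top" and lap: "((\<lambda>r. f2 r + f1 r / r) \<longlongrightarrow> 0) at_top"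
  shows "(f1 \<longlongrightarrow> 0) at_top"
proof (rule tendstoI)
  fix e :: real assume "e > 0"
  \<comment> \<open>The two error terms below bound the slope at \<open>r\<close> by
    \<open>4 \<epsilon> = e / 2\<close>.\<close>
  define \<epsilon> where "\<epsilon> = e / 8"
  have e: "\<epsilon> > 0" using \<open>e > 0\<close> by (simp add: \<epsilon>_def)
  have "eventually (\<lambda>r. dist (f r) L < \<epsilon> / 2) at_top" "eventually (\<lambda>r. dist (f2 r + f1 r / r) 0 < \<epsilon>) at_top"
    using tendstoD[OF lim, of "\<epsilon> / 2"] tendstoD[OF lap e] e by auto
  then obtain N N' where N: "\<And>r. r \<ge> N \<Longrightarrow> \<bar>f r - L\<bar> < \<epsilon> / 2"
      "\<And>r. r \<ge> N' \<Longrightarrow> \<bar>f2 r + f1 r / r\<bar> < \<epsilon>"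
    by (auto simp: eventually_at_top_linorder dist_real_def)
  have "dist (f1 r) 0 < e" if r: "r \<ge> max 1 (max N N')" for r
  proof -
    have r1: "1 \<le> r" "N \<le> r" "N' \<le> r" using r by auto
    obtain z where z: "r < z" "z < r + 1" "f (r + 1) - f r = (r + 1 - r) * f1 z"
      using MVT2[of r "r + 1" f f1] df r1 by auto
    have "f1 z = f (r + 1) - f r" using z(3) by simp
    then have f1z: "\<bar>f1 z\<bar> < \<epsilon>" using N(1)[of r] N(1)[of "r + 1"] r1 by linarith
    have dh: "((\<lambda>x. x * f1 x) has_real_derivative x * (f2 x + f1 x / x)) (at x)" if "r \<le> x" for x
      using that r1 by (auto intro!: derivative_eq_intros df1 simp: field_simps)
    obtain w where w: "r < w" "w < z" "z * f1 z - r * f1 r = (z - r) * (w * (f2 w + f1 w / w))"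
      using MVT2[OF z(1), of "\<lambda>x. x * f1 x" "\<lambda>x. x * (f2 x + f1 x / x)"] dh by auto
    have "\<bar>z * f1 z\<bar> \<le> 2 * r * \<epsilon>"
      unfolding abs_mult using f1z z r1 by (intro mult_mono) auto
    moreover have "\<bar>(z - r) * (w * (f2 w + f1 w / w))\<bar> \<le> 1 * (2 * r * \<epsilon>)"
      unfolding abs_mult using z w r1 N(2)[of w] by (intro mult_mono) auto
    moreover have "r * f1 r = z * f1 z - (z - r) * (w * (f2 w + f1 w / w))" using w(3) by simp
    moreover have "\<bar>a - b\<bar> \<le> c + d" if "\<bar>a\<bar> \<le> c" "\<bar>b\<bar> \<le> d" for a b c d :: real
      using that by linarith
    ultimately have "\<bar>r * f1 r\<bar> \<le> 2 * r * \<epsilon> + 1 * (2 * r * \<epsilon>)" by metis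
    then have "r * \<bar>f1 r\<bar> \<le> r * (4 * \<epsilon>)" using r1 by (simp add: abs_mult algebra_simps)
    then have "\<bar>f1 r\<bar> \<le> 4 * \<epsilon>" using r1 by simp
    then show ?thesis using e by (simp add: \<epsilon>_def)
  qed
  then show "eventually (\<lambda>r. dist (f1 r) 0 < e) at_top"
    unfolding eventually_at_top_linorder by blast
qed

text \<open>The smaller of \<open>y f\<close> and \<open>g\<close> would have a negative interior
  minimum, and the component attaining it has a local minimum there as well. So each differential
  inequality is asked for only where its component is the smaller one; the weight \<open>y\<close>
  balances the two couplings.\<close>

lemma cooperative_nonneg_at_infinity:
  fixes f f1 f2 g g1 g2 :: "real \<Rightarrow> real"
  assumes "0 < y"
    and df: "\<And>r. M \<le> r \<Longrightarrow> (f has_real_derivative f1 r) (at r)"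
    and df1: "\<And>r. M \<le> r \<Longrightarrow> (f1 has_real_derivative f2 r) (at r)"
    and dg: "\<And>r. M \<le> r \<Longrightarrow> (g has_real_derivative g1 r) (at r)"
    and dg1: "\<And>r. M \<le> r \<Longrightarrow> (g1 has_real_derivative g2 r) (at r)"
    and M: "0 \<le> f M" "0 \<le> g M"
    and lim: "(f \<longlongrightarrow> 0) at_top" "(g \<longlongrightarrow> 0) at_top"
    and f_super: "\<And>r. M < r \<Longrightarrow> f r < 0 \<Longrightarrow> y * f r \<le> g r \<Longrightarrow> f2 r + f1 r / r < 0"
    and g_super: "\<And>r. M < r \<Longrightarrow> g r < 0 \<Longrightarrow> g r \<le> y * f r \<Longrightarrow> g2 r + g1 r / r < 0"
    and "M \<le> r"
  shows "0 \<le> f r"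
proof (rule ccontr)
  assume neg: "\<not> 0 \<le> f r"
  define m where "m x = min (y * f x) (g x)" for x
  have "y * f r < 0" using neg \<open>0 < y\<close> by (simp add: mult_pos_neg)
  then have mr: "m r < 0" by (simp add: m_def)
  have "(m \<longlongrightarrow> min (y * 0) 0) at_top" unfolding m_def by (intro tendsto_intros lim)
  then have "eventually (\<lambda>x. m r < m x) at_top" using order_tendstoD(1) mr by simp
  then obtain N where N: "\<And>x. x \<ge> N \<Longrightarrow> m r < m x" by (auto simp: eventually_at_top_linorder)
  define b where "b = max N (r + 1)"
  have b: "r < b" "N \<le> b" by (auto simp: b_def)
  have "continuous_on {M..b} f" "continuous_on {M..b} g"
    using DERIV_continuous_on df dg has_field_derivative_at_within by (metis atLeastAtMost_iff)+
  then have "continuous_on {M..b} m" unfolding m_def by (intro continuous_intros)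
  then obtain x where x: "x \<in> {M..b}" "\<And>z. z \<in> {M..b} \<Longrightarrow> m x \<le> m z"
    using continuous_attains_inf[of "{M..b}" m] b \<open>M \<le> r\<close> by auto
  have mx: "m x \<le> m r" using x(2)[of r] b \<open>M \<le> r\<close> by simp
  have "0 \<le> m M" using M \<open>0 < y\<close> by (simp add: m_def)
  then have "x \<noteq> M" using mx mr by auto
  moreover have "x \<noteq> b" using mx N[of b] b by auto
  ultimately have xi: "M < x" "x < b" using x(1) by auto
  define d where "d = min (x - M) (b - x)"
  have d: "0 < d" using xi by (simp add: d_def)
  have near: "z \<in> {M..b}" "M \<le> z" if "\<bar>z - x\<bar> < d" for z
    using that by (auto simp: d_def abs_less_iff)
  have min_z: "m x \<le> y * f z" "m x \<le> g z" if "\<bar>z - x\<bar> < d" for z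
    using x(2)[OF near(1)[OF that]] by (auto simp: m_def)
  consider "m x = y * f x" | "m x = g x" by (cases "y * f x \<le> g x") (auto simp: m_def)
  then show False
  proof cases
    case 1
    have "f x \<le> f z" if "\<bar>z - x\<bar> < d" for z
      using min_z[OF that] 1 \<open>0 < y\<close> by simp
    from local_min_second_derivative[OF d df[OF near(2)] df1 this] xi
    have "f1 x = 0" "0 \<le> f2 x" by auto
    moreover have "y * f x < 0" using 1 mx mr by simp
    then have "f x < 0" using \<open>0 < y\<close> by (simp add: mult_less_0_iff)
    moreover have "y * f x \<le> g x" using min_z[of x] d 1 by simp
    ultimately show False using f_super[OF xi(1)] by simp
  next
    case 2
    have "g x \<le> g z" if "\<bar>z - x\<bar> < d" for z
      using min_z[OF that] 2 by simp
    from local_min_second_derivative[OF d dg[OF near(2)] dg1 this] xi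
    have "g1 x = 0" "0 \<le> g2 x" by auto
    moreover have "g x < 0" using 2 mx mr by simp
    moreover have "g x \<le> y * f x" using min_z[of x] d 2 by simp
    ultimately show False using g_super[OF xi(1)] by simp
  qed
qed

section \<open>The system differentiated once\<close>

context radial_profile
begin

definition hU :: "real \<Rightarrow> real" where
  "hU r = \<beta> - 4 * \<gamma> - \<beta> * V r + \<gamma> * (9 * (U r)^2 + (V r)^2)"

definition gV :: "real \<Rightarrow> real" where
  "gV r = \<beta> - 4 * \<gamma> + \<beta> * V r + 3 * \<gamma> * ((U r)^2 + (V r)^2)"

definition coup :: "real \<Rightarrow> real" where
  "coup r = U r * (\<sigma> * (\<beta> - 2 * \<gamma> * V r))"

lemma coup_nonneg: "0 < r \<Longrightarrow> ereal r < R \<Longrightarrow> 0 \<le> coup r"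
  using sign_coupling[of "V r" "V r"] V_sign_le[of r] U_pos[of r]
  by (simp add: coup_def mult.left_commute[of \<gamma>] mult.assoc)

lemma coup_pos: "\<beta> \<noteq> 2 * \<gamma> \<Longrightarrow> 0 < r \<Longrightarrow> ereal r < R \<Longrightarrow> 0 < coup r"
  using sign_coupling_strict[of "V r"] V_sign_le[of r] U_pos[of r]
  by (simp add: coup_def mult.left_commute[of \<gamma>] mult.assoc)

text \<open>Here \<open>hU\<close>, \<open>gV\<close> are the diagonal partial derivatives of the nonlinearity, while \<open>- \<sigma> coup\<close> and \<open>- 3 \<sigma> coup\<close>
  are the mixed ones; \<open>coup \<ge> 0\<close> is what makes the system cooperative.\<close>

definition U3 :: "real \<Rightarrow> real" where
  "U3 r = ((K + 1) / r^2 + hU r) * U1 r - coup r * (\<sigma> * V1 r) - 2 * K * U r / r^3 - U2 r / r"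

definition V3 :: "real \<Rightarrow> real" where
  "V3 r = (1 / r^2 + gV r) * V1 r - 3 * (\<sigma> * coup r) * U1 r - V2 r / r"

text \<open>The right side of the equation for \<open>U\<close> is differentiable again, so the
  third derivative comes from the equation itself. Differentiating the drift \<open>U1 / r\<close>
  contributes the extra 1 in \<open>K + 1\<close>.\<close>

lemma dU2:
  assumes r: "0 < r" "ereal r < R"
  shows "(U2 has_real_derivative U3 r) (at r)"
proof -
  obtain d where d: "0 < d" "\<And>y. \<bar>y - r\<bar> < d \<Longrightarrow> 0 < y \<and> ereal y < R"
    using obtain_radius[OF r] by blast
  have "((\<lambda>r. K * U r / r^2 + hn \<beta> \<gamma> (U r) (V r) - U1 r / r) has_real_derivative U3 r) (at r)"
  proof -
    have "((\<lambda>r. K * U r / r^2 + hn \<beta> \<gamma> (U r) (V r) - U1 r / r) has_real_derivative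
      (K * U1 r / r^2 - 2 * K * U r / r^3) + (hU r * U1 r - U r * (\<beta> - 2 * \<gamma> * V r) * V1 r)
       - (U2 r / r - U1 r / r^2)) (at r)"
    proof (intro DERIV_diff DERIV_add)
      show "((\<lambda>r. K * U r / r^2) has_real_derivative (K * U1 r / r^2 - 2 * K * U r / r^3)) (at r)"
        using r by (auto intro!: derivative_eq_intros dU simp: field_simps eval_nat_numeral)
      show "((\<lambda>r. hn \<beta> \<gamma> (U r) (V r)) has_real_derivative
          (hU r * U1 r - U r * (\<beta> - 2 * \<gamma> * V r) * V1 r)) (at r)"
        unfolding hn_def hU_def using r
        by (auto intro!: derivative_eq_intros dU dV simp: algebra_simps power2_eq_square)
      show "((\<lambda>r. U1 r / r) has_real_derivative (U2 r / r - U1 r / r^2)) (at r)"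
        using r by (auto intro!: derivative_eq_intros dU1 simp: field_simps power2_eq_square)
    qed
    moreover have c: "coup r * (\<sigma> * V1 r) = U r * (\<beta> - 2 * \<gamma> * V r) * V1 r"
      unfolding coup_def using sign by auto
    have "U3 r = (K * U1 r / r^2 - 2 * K * U r / r^3) + (hU r * U1 r - U r * (\<beta> - 2 * \<gamma> * V r) * V1 r)
       - (U2 r / r - U1 r / r^2)"
      unfolding U3_def c by (simp add: distrib_right add_divide_distrib)
    ultimately show ?thesis by (simp only:)
  qed
  then show ?thesis
    by (rule has_field_derivative_transform_within[OF _ d(1)])
      (use d(2) U_eq in \<open>auto simp: dist_real_def\<close>)
qed

lemma dV2:
  assumes r: "0 < r" "ereal r < R"
  shows "(V2 has_real_derivative V3 r) (at r)"
proof -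
  obtain d where d: "0 < d" "\<And>y. \<bar>y - r\<bar> < d \<Longrightarrow> 0 < y \<and> ereal y < R"
    using obtain_radius[OF r] by blast
  have "((\<lambda>r. gn \<beta> \<gamma> (U r) (V r) - V1 r / r) has_real_derivative V3 r) (at r)"
  proof -
    have "((\<lambda>r. gn \<beta> \<gamma> (U r) (V r) - V1 r / r) has_real_derivative
      (gV r * V1 r - 3 * U r * (\<beta> - 2 * \<gamma> * V r) * U1 r) - (V2 r / r - V1 r / r^2)) (at r)"
    proof (intro DERIV_diff)
      show "((\<lambda>r. gn \<beta> \<gamma> (U r) (V r)) has_real_derivative
          (gV r * V1 r - 3 * U r * (\<beta> - 2 * \<gamma> * V r) * U1 r)) (at r)"
        unfolding gn_def gV_def using r
        by (auto intro!: derivative_eq_intros dU dV simp: algebra_simps power2_eq_square)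
      show "((\<lambda>r. V1 r / r) has_real_derivative (V2 r / r - V1 r / r^2)) (at r)"
        using r by (auto intro!: derivative_eq_intros dV1 simp: field_simps power2_eq_square)
    qed
    moreover have c: "\<sigma> * coup r = U r * (\<beta> - 2 * \<gamma> * V r)"
      unfolding coup_def using sign by auto
    have "V3 r = (gV r * V1 r - 3 * U r * (\<beta> - 2 * \<gamma> * V r) * U1 r) - (V2 r / r - V1 r / r^2)"
      unfolding V3_def c by (simp add: distrib_right)
    ultimately show ?thesis by (simp only:)
  qed
  then show ?thesis
    by (rule has_field_derivative_transform_within[OF _ d(1)])
      (use d(2) V_eq in \<open>auto simp: dist_real_def\<close>)
qed

lemma sign_V3: "\<sigma> * V3 r = (1 / r^2 + gV r) * (\<sigma> * V1 r) - 3 * coup r * U1 r - \<sigma> * V2 r / r"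
  by (simp add: V3_def algebra_simps)

subsection \<open>Monotonicity near the outer end\<close>

lemma
  shows hU_lim: "(hU \<longlongrightarrow> 6 * \<gamma>) (end_filter R)"
    and gV_lim: "(gV \<longlongrightarrow> 2 * \<beta> + 2 * \<gamma>) (end_filter R)"
    and coup_lim: "(coup \<longlongrightarrow> \<sigma> * (\<beta> - 2 * \<gamma>)) (end_filter R)"
    and hn_lim: "((\<lambda>r. hn \<beta> \<gamma> (U r) (V r)) \<longlongrightarrow> 0) (end_filter R)"
    and gn_lim: "((\<lambda>r. gn \<beta> \<gamma> (U r) (V r)) \<longlongrightarrow> 0) (end_filter R)"
proof -
  have "(hU \<longlongrightarrow> \<beta> - 4 * \<gamma> - \<beta> * 1 + \<gamma> * (9 * 1^2 + 1^2)) (end_filter R)"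
    unfolding hU_def by (intro tendsto_intros U_lim V_lim)
  then show "(hU \<longlongrightarrow> 6 * \<gamma>) (end_filter R)" by simp
  have "(gV \<longlongrightarrow> \<beta> - 4 * \<gamma> + \<beta> * 1 + 3 * \<gamma> * (1^2 + 1^2)) (end_filter R)"
    unfolding gV_def by (intro tendsto_intros U_lim V_lim)
  then show "(gV \<longlongrightarrow> 2 * \<beta> + 2 * \<gamma>) (end_filter R)" by (simp add: algebra_simps)
  have "(coup \<longlongrightarrow> 1 * (\<sigma> * (\<beta> - 2 * \<gamma> * 1))) (end_filter R)"
    unfolding coup_def by (intro tendsto_intros U_lim V_lim)
  then show "(coup \<longlongrightarrow> \<sigma> * (\<beta> - 2 * \<gamma>)) (end_filter R)" by simp
  have "((\<lambda>r. hn \<beta> \<gamma> (U r) (V r)) \<longlongrightarrow> hn \<beta> \<gamma> 1 1) (end_filter R)"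
    unfolding hn_def by (intro tendsto_intros U_lim V_lim)
  then show "((\<lambda>r. hn \<beta> \<gamma> (U r) (V r)) \<longlongrightarrow> 0) (end_filter R)" by (simp add: hn_1_1)
  have "((\<lambda>r. gn \<beta> \<gamma> (U r) (V r)) \<longlongrightarrow> gn \<beta> \<gamma> 1 1) (end_filter R)"
    unfolding gn_def by (intro tendsto_intros U_lim V_lim)
  then show "((\<lambda>r. gn \<beta> \<gamma> (U r) (V r)) \<longlongrightarrow> 0) (end_filter R)" by (simp add: gn_1_1)
qed

text \<open>\<open>(r U1)' = K U / r + r hn\<close>, and near a finite end \<open>hn\<close> is
  negligible against the centrifugal term, so \<open>r U1\<close> increases. It is positive
  somewhere arbitrarily close to the end, because \<open>U < 1\<close> has limit 1.\<close>

lemma U1_pos_near_finite_end: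
  assumes "R = ereal b"
  shows "eventually (\<lambda>r. 0 < U1 r) (end_filter R)"
proof -
  have b: "0 < b" using R assms by simp
  have "((\<lambda>r. K * U r / r + r * hn \<beta> \<gamma> (U r) (V r)) \<longlongrightarrow> K * 1 / b + b * 0) (end_filter R)"
  proof (intro tendsto_intros U_lim hn_lim)
    show "((\<lambda>r. r) \<longlongrightarrow> b) (end_filter R)" "((\<lambda>r. r) \<longlongrightarrow> b) (end_filter R)"
      by (simp_all add: assms end_filter_def)
  qed (use b in simp)
  then have "eventually (\<lambda>r. 0 < K * U r / r + r * hn \<beta> \<gamma> (U r) (V r)) (end_filter R)"
    by (rule order_tendstoD(1)) (use K b in simp)
  then obtain N where N: "0 < N" "ereal N < R"
      "\<And>r. N < r \<Longrightarrow> ereal r < R \<Longrightarrow> 0 < K * U r / r + r * hn \<beta> \<gamma> (U r) (V r)"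
    unfolding eventually_end_filter[OF R] by blast
  have d: "((\<lambda>r. r * U1 r) has_real_derivative K * U r / r + r * hn \<beta> \<gamma> (U r) (V r)) (at r)"
    if "0 < r" "ereal r < R" for r
    using that by (auto intro!: derivative_eq_intros dU1 simp: U_eq field_simps power2_eq_square)
  obtain N' where N': "N < N'" "ereal N' < R"
    using ereal_dense2[OF N(2)] by auto
  obtain s where s: "N' \<le> s" "ereal s < R" "0 < U1 s"
  proof (rule ccontr)
    assume "\<not> thesis"
    then have "U1 x \<le> 0" if "N' \<le> x" "ereal x < R" for x using that \<open>\<And>s. \<lbrakk>N' \<le> s; ereal s < R; 0 < U1 s\<rbrakk> \<Longrightarrow> thesis\<close> by force
    then have "1 \<le> U N'"
      by (intro limit_le_of_deriv_nonpos[OF U_lim _ N'(2) dU]) (use N N' in auto)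
    then show False using U_less_1[of N'] N N' by simp
  qed
  have "0 < U1 r" if r: "s < r" "ereal r < R" for r
  proof -
    have "s * U1 s < r * U1 r"
    proof (rule DERIV_pos_imp_increasing[OF r(1)])
      fix x assume "s \<le> x" "x \<le> r"
      then have "N < x" "0 < x" "ereal x < R" using s N N' r less_R[of x r] by auto
      then show "\<exists>y. ((\<lambda>r. r * U1 r) has_real_derivative y) (at x) \<and> 0 < y" using d N(3) by blast
    qed
    moreover have "0 < s * U1 s" using s N N' by simp
    ultimately have "0 < r * U1 r" by simp
    then show ?thesis using r s N N' by (simp add: zero_less_mult_iff)
  qed
  then show ?thesis unfolding eventually_end_filter[OF R] using s N N'
    by (intro exI[of _ s]) auto
qed

text \<open>With \<open>e = \<sigma> (\<beta> - 2 \<gamma>)\<close>, the zero-order matrix of the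
  differentiated system tends to one with diagonal \<open>6 \<gamma>\<close>,
  \<open>2 \<beta> + 2 \<gamma>\<close> and off-diagonal entries \<open>- e\<close>,
  \<open>- 3 e\<close>. Its determinant \<open>3 \<beta> (8 \<gamma> - \<beta>)\<close> is positive
  as \<open>\<beta> \<le> 4 \<gamma>\<close>, so some positive vector \<open>(1, y)\<close> has a
  positive image.\<close>

lemma coupling_weight:
  "\<exists>y>0. \<sigma> * (\<beta> - 2 * \<gamma>) * y < 6 * \<gamma> \<and> 3 * (\<sigma> * (\<beta> - 2 * \<gamma>)) < (2 * \<beta> + 2 * \<gamma>) * y"
  using sign
proof
  assume "\<sigma> = 1"
  then show ?thesis using \<beta> \<gamma> \<beta>_le by (intro exI[of _ 2]) (auto simp: algebra_simps)
next
  assume "\<sigma> = - 1"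
  then show ?thesis using \<beta> \<gamma> \<beta>_le by (intro exI[of _ 3]) (auto simp: algebra_simps)
qed

text \<open>The source \<open>-2KU/r\<^sup>3\<close> in the equation of \<open>U1\<close> beats the homogeneous
  solutions of the linearised system, which are dominated by \<open>r\<^sup>-\<^sup>4\<close>.\<close>

lemma U1_pos_near_infinity:
  assumes R_inf: "R = \<infinity>"
  shows "eventually (\<lambda>r. 0 < U1 r) (end_filter R)"
proof -
  have top: "end_filter R = at_top" by (simp add: R_inf end_filter_def)
  have in_dom: "ereal r < R" for r using R_inf by simp
  note lims = hU_lim gV_lim coup_lim hn_lim gn_lim U_lim V_lim
  note lims = lims[unfolded top]
  have inv: "((\<lambda>r::real. c / r ^ n) \<longlongrightarrow> 0) at_top" if "0 < n" for c n
    using that by (intro real_tendsto_divide_at_top[OF tendsto_const] filterlim_pow_at_top filterlim_ident)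
  have U1_lim: "(U1 \<longlongrightarrow> 0) at_top"
  proof (rule radial_deriv_tendsto_0[OF dU dU1 lims(6)])
    have "((\<lambda>r. K / r^2 * U r + hn \<beta> \<gamma> (U r) (V r)) \<longlongrightarrow> 0 * 1 + 0) at_top"
      by (intro tendsto_intros lims inv) simp
    then have "((\<lambda>r. K / r^2 * U r + hn \<beta> \<gamma> (U r) (V r)) \<longlongrightarrow> 0) at_top" by simp
    then show "((\<lambda>r. U2 r + U1 r / r) \<longlongrightarrow> 0) at_top"
      by (rule Lim_transform_eventually)
        (use U_eq in_dom in \<open>auto intro!: eventually_mono[OF eventually_gt_at_top[of 0]]\<close>)
  qed (use in_dom in auto)
  have V1_lim: "(V1 \<longlongrightarrow> 0) at_top"
  proof (rule radial_deriv_tendsto_0[OF dV dV1 lims(7)])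
    show "((\<lambda>r. V2 r + V1 r / r) \<longlongrightarrow> 0) at_top"
      using lims(5) by (rule Lim_transform_eventually)
        (use V_eq in_dom in \<open>auto intro!: eventually_mono[OF eventually_gt_at_top[of 0]]\<close>)
  qed (use in_dom in auto)
  define e where "e = \<sigma> * (\<beta> - 2 * \<gamma>)"
  obtain y where y: "0 < y" "e * y < 6 * \<gamma>" "3 * e < (2 * \<beta> + 2 * \<gamma>) * y"
    using coupling_weight by (auto simp: e_def)
  define A where "A r = (K + 1) / r^2 + hU r" for r
  define B where "B r = 1 / r^2 + gV r" for r
  have A_lim: "(A \<longlongrightarrow> 0 + 6 * \<gamma>) at_top" unfolding A_def by (intro tendsto_intros lims inv) simp
  have B_lim: "(B \<longlongrightarrow> 0 + (2 * \<beta> + 2 * \<gamma>)) at_top" unfolding B_def by (intro tendsto_intros lims inv) simp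
  \<comment> \<open>The radial Laplacian multiplies the barrier \<open>1 / r^4\<close> by
    \<open>(20 - 4) / r^2\<close>.\<close>
  have "((\<lambda>r. A r - coup r * y - 16 / r^2) \<longlongrightarrow> (0 + 6 * \<gamma>) - e * y - 0) at_top"
    unfolding e_def by (intro tendsto_intros lims inv A_lim) simp
  then have ev1: "eventually (\<lambda>r. 0 < A r - coup r * y - 16 / r^2) at_top"
    by (rule order_tendstoD(1)) (use y in simp)
  have "((\<lambda>r. B r * y - 3 * coup r - 16 * y / r^2) \<longlongrightarrow> (0 + (2 * \<beta> + 2 * \<gamma>)) * y - 3 * e - 0) at_top"
    unfolding e_def by (intro tendsto_intros lims inv B_lim) simp
  then have ev2: "eventually (\<lambda>r. 0 < B r * y - 3 * coup r - 16 * y / r^2) at_top"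
    by (rule order_tendstoD(1)) (use y in simp)
  have ev3: "eventually (\<lambda>r. A r < 6 * \<gamma> + 1) at_top" by (rule order_tendstoD(2)[OF A_lim]) simp
  have ev4: "eventually (\<lambda>r. 1 / 2 < U r) at_top" by (rule order_tendstoD(1)[OF lims(6)]) simp
  from eventually_conj[OF eventually_conj[OF ev1 ev2] eventually_conj[OF ev3 ev4]]
  obtain M0 where M0: "\<And>r. M0 \<le> r \<Longrightarrow> 0 < A r - coup r * y - 16 / r^2 \<and>
      0 < B r * y - 3 * coup r - 16 * y / r^2 \<and> A r < 6 * \<gamma> + 1 \<and> 1 / 2 < U r"
    by (auto simp: eventually_at_top_linorder)
  define M where "M = max M0 1"
  have M: "1 \<le> M" "\<And>r. M \<le> r \<Longrightarrow> M0 \<le> r" by (auto simp: M_def)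
  \<comment> \<open>Small enough that the reaction \<open>\<epsilon> A / r^3\<close> of the lower
    barrier stays below the source \<open>2 K U / r^3\<close>, since eventually
    \<open>A < 6 \<gamma> + 1\<close> and \<open>2 U > 1\<close>.\<close>
  define \<epsilon> where "\<epsilon> = K / (6 * \<gamma> + 1)"
  have eps: "0 < \<epsilon>" "\<epsilon> * (6 * \<gamma> + 1) = K" using K \<gamma> by (simp_all add: \<epsilon>_def)
  \<comment> \<open>Large enough to lift both components to at least 0 at \<open>M\<close>. The
    shift \<open>(C, y C) / r^4\<close> has the direction found in
    \<open>coupling_weight\<close>.\<close>
  define C where "C = M^4 * (\<bar>U1 M\<bar> + \<epsilon> / M^3 + \<bar>V1 M\<bar> / y)"
  have C: "0 \<le> C" using eps y M by (simp add: C_def)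
  define f where "f r = U1 r - \<epsilon> / r^3 + C / r^4" for r
  define f1 where "f1 r = U2 r + 3 * \<epsilon> / r^4 - 4 * C / r^5" for r
  define f2 where "f2 r = U3 r - 12 * \<epsilon> / r^5 + 20 * C / r^6" for r
  define g where "g r = \<sigma> * V1 r + y * C / r^4" for r
  define g1 where "g1 r = \<sigma> * V2 r - 4 * (y * C) / r^5" for r
  define g2 where "g2 r = \<sigma> * V3 r + 20 * (y * C) / r^6" for r
  have p3: "((\<lambda>r. a / r^3) has_real_derivative - 3 * a / r^4) (at r)" if "M \<le> r" for a r :: real
    using that M(1) by (auto intro!: derivative_eq_intros simp: field_simps eval_nat_numeral)
  have p4: "((\<lambda>r. a / r^4) has_real_derivative - 4 * a / r^5) (at r)" if "M \<le> r" for a r :: real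
    using that M(1) by (auto intro!: derivative_eq_intros simp: field_simps eval_nat_numeral)
  have p5: "((\<lambda>r. a / r^5) has_real_derivative - 5 * a / r^6) (at r)" if "M \<le> r" for a r :: real
    using that M(1) by (auto intro!: derivative_eq_intros simp: field_simps eval_nat_numeral)
  have f_nonneg: "0 \<le> f r" if "M \<le> r" for r
  proof (rule cooperative_nonneg_at_infinity[OF y(1), where f = f and g = g and M = M])
    show "(f has_real_derivative f1 r) (at r)" if "M \<le> r" for r
    proof -
      have "(f has_real_derivative U2 r - (- 3 * \<epsilon> / r^4) + (- 4 * C / r^5)) (at r)"
        unfolding f_def by (intro DERIV_add DERIV_diff dU1 p3 p4) (use that M(1) in_dom in auto)
      then show ?thesis by (simp add: f1_def)
    qed
    show "(f1 has_real_derivative f2 r) (at r)" if "M \<le> r" for r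
    proof -
      have "(f1 has_real_derivative U3 r + (- 4 * (3 * \<epsilon>) / r^5) - (- 5 * (4 * C) / r^6)) (at r)"
        unfolding f1_def by (intro DERIV_add DERIV_diff dU2 p4 p5) (use that M(1) in_dom in auto)
      then show ?thesis by (simp add: f2_def)
    qed
    show "(g has_real_derivative g1 r) (at r)" if "M \<le> r" for r
    proof -
      have "(g has_real_derivative \<sigma> * V2 r + (- 4 * (y * C) / r^5)) (at r)"
        unfolding g_def by (intro DERIV_add DERIV_cmult dV1 p4) (use that M(1) in_dom in auto)
      then show ?thesis by (simp add: g1_def)
    qed
    show "(g1 has_real_derivative g2 r) (at r)" if "M \<le> r" for r
    proof -
      have "(g1 has_real_derivative \<sigma> * V3 r - (- 5 * (4 * (y * C)) / r^6)) (at r)"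
        unfolding g1_def by (intro DERIV_diff DERIV_cmult dV2 p5) (use that M(1) in_dom in auto)
      then show ?thesis by (simp add: g2_def)
    qed
    have CM: "C / M^4 = \<bar>U1 M\<bar> + \<epsilon> / M^3 + \<bar>V1 M\<bar> / y" using M by (simp add: C_def)
    have "0 \<le> \<bar>V1 M\<bar> / y" using y by simp
    then show "0 \<le> f M" unfolding f_def CM by linarith
    have "y * C / M^4 = y * (\<bar>U1 M\<bar> + \<epsilon> / M^3) + \<bar>V1 M\<bar>"
      using CM y by (simp add: field_simps)
    moreover have "0 \<le> y * (\<bar>U1 M\<bar> + \<epsilon> / M^3)" using y eps M by simp
    moreover have "\<bar>\<sigma> * V1 M\<bar> = \<bar>V1 M\<bar>" using sign by auto
    ultimately show "0 \<le> g M" unfolding g_def by linarith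
    have "(f \<longlongrightarrow> 0 - 0 + 0) at_top" unfolding f_def by (intro tendsto_intros U1_lim inv) simp_all
    then show "(f \<longlongrightarrow> 0) at_top" by simp
    have "(g \<longlongrightarrow> \<sigma> * 0 + 0) at_top" unfolding g_def by (intro tendsto_intros V1_lim inv) simp_all
    then show "(g \<longlongrightarrow> 0) at_top" by simp
  next
    fix r assume r: "M < r" and fr: "f r < 0" and gr: "y * f r \<le> g r"
    have r0: "0 < r" using r M by simp
    note bd = M0[OF M(2)[OF less_imp_le[OF r]]]
    have co: "0 \<le> coup r" using coup_nonneg[OF r0 in_dom] .
    have "f2 r + f1 r / r = A r * U1 r - coup r * (\<sigma> * V1 r) - 2 * K * U r / r^3
        - 9 * \<epsilon> / r^5 + 16 * C / r^6"
      using r0 unfolding f2_def f1_def U3_def A_def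
      by (simp add: field_simps eval_nat_numeral)
    also have "\<dots> = A r * f r - coup r * g r + (\<epsilon> * A r - 2 * K * U r) / r^3 - 9 * \<epsilon> / r^5
        - C / r^4 * (A r - coup r * y - 16 / r^2)"
      using r0 unfolding f_def g_def by (simp add: field_simps eval_nat_numeral)
    also have "\<dots> < 0"
    proof -
      have "\<epsilon> * A r < \<epsilon> * (6 * \<gamma> + 1)" using bd eps by (intro mult_strict_left_mono) auto
      moreover have "K * 1 < K * (2 * U r)" using bd K by (intro mult_strict_left_mono) auto
      ultimately have "(\<epsilon> * A r - 2 * K * U r) / r^3 < 0"
        using eps r0 by (simp add: divide_neg_pos)
      moreover have "0 \<le> 9 * \<epsilon> / r^5" using eps r0 by simp
      moreover have "0 \<le> C / r^4 * (A r - coup r * y - 16 / r^2)" using bd C r0 by simp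
      moreover have "A r * f r - coup r * g r \<le> 0"
      proof -
        have "coup r * (y * f r) \<le> coup r * g r" using gr co by (rule mult_left_mono)
        moreover have "0 \<le> 16 / r^2" by simp
        then have "(A r - coup r * y) * f r \<le> 0" using bd fr
          by (intro mult_nonneg_nonpos) linarith+
        ultimately show ?thesis by (simp add: algebra_simps)
      qed
      ultimately show ?thesis by linarith
    qed
    finally show "f2 r + f1 r / r < 0" .
  next
    fix r assume r: "M < r" and gr: "g r < 0" and fr: "g r \<le> y * f r"
    have r0: "0 < r" using r M by simp
    note bd = M0[OF M(2)[OF less_imp_le[OF r]]]
    have co: "0 \<le> coup r" using coup_nonneg[OF r0 in_dom] .
    have "g2 r + g1 r / r = B r * (\<sigma> * V1 r) - 3 * coup r * U1 r + 16 * (y * C) / r^6"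
      using r0 unfolding g2_def g1_def sign_V3 B_def
      by (simp add: field_simps eval_nat_numeral)
    also have "\<dots> = B r * g r - 3 * coup r * f r - 3 * coup r * \<epsilon> / r^3
        - C / r^4 * (B r * y - 3 * coup r - 16 * y / r^2)"
      using r0 unfolding f_def g_def by (simp add: field_simps eval_nat_numeral)
    also have "\<dots> < 0"
    proof -
      have "0 \<le> 3 * coup r * \<epsilon> / r^3" using co eps r0 by simp
      moreover have "0 \<le> C / r^4 * (B r * y - 3 * coup r - 16 * y / r^2)" using bd C r0 by simp
      moreover have "B r * g r - 3 * coup r * f r < 0"
      proof -
        have "3 * coup r * g r \<le> 3 * coup r * (y * f r)" using fr co by (intro mult_left_mono) auto
        moreover have "0 \<le> 16 * y / r^2" using y by simp
        then have "(B r * y - 3 * coup r) * g r < 0" using bd gr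
          by (intro mult_pos_neg) linarith+
        ultimately have "y * (B r * g r - 3 * coup r * f r) < 0" by (simp add: algebra_simps)
        then show ?thesis using y by (simp add: mult_less_0_iff)
      qed
      ultimately show ?thesis by linarith
    qed
    finally show "g2 r + g1 r / r < 0" .
  qed (fact that)
  \<comment> \<open>Beyond \<open>C / \<epsilon>\<close> the source-driven
    \<open>\<epsilon> / r^3\<close> outweighs the correction \<open>C / r^4\<close>.\<close>
  have "0 < U1 r" if r: "max M (C / \<epsilon>) < r" for r
  proof -
    have r0: "0 < r" using r M by simp
    have "C < \<epsilon> * r" using r eps by (simp add: field_simps)
    then have "C / r^4 < \<epsilon> / r^3" using r0 by (simp add: field_simps eval_nat_numeral)
    then show ?thesis using f_nonneg[of r] r by (simp add: f_def)
  qed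
  then show ?thesis unfolding top eventually_at_top_dense by blast
qed

lemma U1_pos_near_end: "eventually (\<lambda>r. 0 < U1 r) (end_filter R)"
  using U1_pos_near_finite_end U1_pos_near_infinity R by (cases R) auto

text \<open>The equation for \<open>V1\<close> has no explicit source; the positive
  \<open>U1\<close> acts as one through the coupling. Where also \<open>gV > 0\<close>, it excludes
  a nonpositive interior minimum of \<open>\<sigma> V1\<close>. Such a minimum would exist if
  positivity failed between two points where it holds.\<close>

lemma V1_pos_near_end:
  assumes ne: "\<beta> \<noteq> 2 * \<gamma>"
  shows "eventually (\<lambda>r. 0 < \<sigma> * V1 r) (end_filter R)"
proof -
  have "eventually (\<lambda>r. 0 < gV r) (end_filter R)"
    by (rule order_tendstoD(1)[OF gV_lim]) (use \<beta> \<gamma> in simp)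
  from eventually_conj[OF this U1_pos_near_end]
  obtain N where N: "0 < N" "ereal N < R"
      "\<And>r. N < r \<Longrightarrow> ereal r < R \<Longrightarrow> 0 < gV r \<and> 0 < U1 r"
    unfolding eventually_end_filter[OF R] by blast
  have ex: "\<exists>s\<ge>r. ereal s < R \<and> 0 < \<sigma> * V1 s" if r: "0 < r" "ereal r < R" for r
  proof (rule ccontr)
    assume "\<not> ?thesis"
    then have "\<sigma> * V1 x \<le> 0" if "r \<le> x" "ereal x < R" for x using that by force
    then have "\<sigma> * 1 \<le> \<sigma> * V r"
      using r by (intro limit_le_of_deriv_nonpos[OF tendsto_mult[OF tendsto_const V_lim] r DERIV_cmult[OF dV]]) auto
    then show False using V_sign_less[OF ne r] by simp
  qed
  obtain N' where N': "N < N'" "ereal N' < R"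
    using ereal_dense2[OF N(2)] by auto
  obtain s where s: "N' \<le> s" "ereal s < R" "0 < \<sigma> * V1 s" using ex[of N'] N N' by auto
  have "0 < \<sigma> * V1 r" if r: "s < r" "ereal r < R" for r
  proof (rule ccontr)
    assume neg: "\<not> 0 < \<sigma> * V1 r"
    obtain t where t: "r \<le> t" "ereal t < R" "0 < \<sigma> * V1 t" using ex[of r] r s N N' by auto
    have dom: "0 < x" "N < x" "ereal x < R" if "s \<le> x" "x \<le> t" for x
      using that s t N N' less_R[of x t] by auto
    have "continuous_on {s..t} (\<lambda>r. \<sigma> * V1 r)"
      by (rule DERIV_continuous_on[where D = "\<lambda>r. \<sigma> * V2 r"], rule has_field_derivative_at_within,
          rule DERIV_cmult, rule dV1) (use dom in auto)
    then obtain m where m: "m \<in> {s..t}" "\<And>z. z \<in> {s..t} \<Longrightarrow> \<sigma> * V1 m \<le> \<sigma> * V1 z"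
      using continuous_attains_inf[of "{s..t}" "\<lambda>r. \<sigma> * V1 r"] r t by auto
    have le0: "\<sigma> * V1 m \<le> 0" using m(2)[of r] neg r t by simp
    then have mi: "s < m" "m < t" using m(1) s(3) t(3) by (cases "m = s"; cases "m = t"; force)+
    define d where "d = min (m - s) (t - m)"
    have d: "0 < d" using mi by (simp add: d_def)
    have near: "s \<le> z" "z \<le> t" if "\<bar>z - m\<bar> < d" for z
      using that by (auto simp: d_def abs_less_iff)
    have dm: "0 < m" "N < m" "ereal m < R" using dom[of m] mi by auto
    have V2m: "\<sigma> * V2 m = 0" and "0 \<le> \<sigma> * V3 m"
      using local_min_second_derivative[OF d DERIV_cmult[OF dV1] DERIV_cmult[OF dV2[OF dm(1,3)]], of \<sigma>]
        dom near m(2) by auto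
    moreover have "(1 / m^2 + gV m) * (\<sigma> * V1 m) \<le> 0"
      using N(3)[OF dm(2,3)] by (intro mult_nonneg_nonpos[OF _ le0] add_nonneg_nonneg) auto
    moreover have "0 < 3 * coup m * U1 m" using coup_pos[OF ne dm(1,3)] N(3)[OF dm(2,3)] by simp
    ultimately show False unfolding sign_V3 V2m by linarith
  qed
  then show ?thesis unfolding eventually_end_filter[OF R] using s N N'
    by (intro exI[of _ s]) auto
qed

end

context radial_profile
begin

subsection \<open>Moving planes\<close>

definition ordered :: "real \<Rightarrow> bool" where
  "ordered \<kappa> \<longleftrightarrow> reflection_ordered R U \<kappa> \<and> reflection_ordered R (\<lambda>r. \<sigma> * V r) \<kappa>"

lemma dW: "0 < r \<Longrightarrow> ereal r < R \<Longrightarrow> ((\<lambda>r. \<sigma> * V r) has_real_derivative \<sigma> * V1 r) (at r)"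
  and dW1: "0 < r \<Longrightarrow> ereal r < R \<Longrightarrow> ((\<lambda>r. \<sigma> * V1 r) has_real_derivative \<sigma> * V2 r) (at r)"
  and dW2: "0 < r \<Longrightarrow> ereal r < R \<Longrightarrow> ((\<lambda>r. \<sigma> * V2 r) has_real_derivative \<sigma> * V3 r) (at r)"
  by (rule DERIV_cmult dV dV1 dV2 | assumption)+

lemma W_cont: "continuous_on {r. 0 \<le> r \<and> ereal r \<le> R} (\<lambda>r. \<sigma> * V r)"
  by (intro continuous_intros V_cont)

text \<open>Equality of the parameters admits both signs, and the two bounds
  \<open>V \<le> 1\<close> and \<open>1 \<le> V\<close> meet.\<close>

lemma V_const:
  assumes eq: "\<beta> = 2 * \<gamma>" and r: "0 \<le> r" "ereal r \<le> R"
  shows "V r = 1"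
proof -
  interpret flip: radial_profile \<beta> \<gamma> K R U U1 U2 V V1 V2 "- \<sigma>"
    by (unfold_locales;
        (fact \<beta> \<gamma> \<beta>_le K R dU dU1 dV dV1 U_eq V_eq U_cont V_cont U_0 V1_0 U_lim V_lim
          U_end V_end U_pos V_pos | use sign eq in auto))
  consider "r = 0" | "0 < r" "ereal r < R" | "ereal r = R" using r by fastforce
  then show ?thesis
  proof cases
    case 1
    then show ?thesis using V_sign_le_0 flip.V_sign_le_0 sign by auto
  next
    case 2
    then show ?thesis using V_sign_le[OF 2] flip.V_sign_le[OF 2] sign by auto
  qed (rule V_end)
qed

lemma ordered_near_end: "\<exists>\<kappa>>0. ereal \<kappa> < R \<and> ordered \<kappa>"
proof -
  obtain N where N: "0 < N" "ereal N < R" "\<And>r. N < r \<Longrightarrow> ereal r < R \<Longrightarrow> 0 < U1 r"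
    using U1_pos_near_end unfolding eventually_end_filter[OF R] by blast
  have lt: "U r < 1" if "0 \<le> r" "ereal r < R" for r
    using U_less_1[of r] U_0 that by (cases "r = 0") auto
  have "\<exists>\<kappa>>0. ereal \<kappa> < R \<and> reflection_ordered R U \<kappa>"
    by (rule reflection_ordered_near_end[OF R U_cont U_lim U_end lt N(1,2) dU])
      (use N in \<open>auto intro: less_imp_le\<close>)
  then obtain \<kappa>1 where \<kappa>1: "0 < \<kappa>1" "ereal \<kappa>1 < R" "reflection_ordered R U \<kappa>1" by blast
  have "\<exists>\<kappa>>0. ereal \<kappa> < R \<and> reflection_ordered R (\<lambda>r. \<sigma> * V r) \<kappa>"
  proof (cases "\<beta> = 2 * \<gamma>")
    case True
    have "reflection_ordered R (\<lambda>r. \<sigma> * V r) N"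
      unfolding reflection_ordered_def
      using V_const[OF True] by (metis ereal_less_eq(3) order_refl order_trans)
    then show ?thesis using N by blast
  next
    case False
    obtain N' where N': "0 < N'" "ereal N' < R" "\<And>r. N' < r \<Longrightarrow> ereal r < R \<Longrightarrow> 0 < \<sigma> * V1 r"
      using V1_pos_near_end[OF False] unfolding eventually_end_filter[OF R] by blast
    have lt: "\<sigma> * V r < \<sigma>" if "0 \<le> r" "ereal r < R" for r
      using V_sign_less[OF False, of r] V_sign_less_0[OF False] that by (cases "r = 0") auto
    have lim: "((\<lambda>r. \<sigma> * V r) \<longlongrightarrow> \<sigma>) (end_filter R)"
      using tendsto_mult[OF tendsto_const V_lim, of \<sigma>] by simp
    show ?thesis
      by (rule reflection_ordered_near_end[OF R W_cont lim _ lt N'(1,2) dW])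
        (use N' V_end in \<open>auto intro: less_imp_le\<close>)
  qed
  then obtain \<kappa>2 where \<kappa>2: "0 < \<kappa>2" "ereal \<kappa>2 < R" "reflection_ordered R (\<lambda>r. \<sigma> * V r) \<kappa>2"
    by blast
  have "ordered (max \<kappa>1 \<kappa>2)"
    unfolding ordered_def using \<kappa>1(3) \<kappa>2(3) by (auto intro: reflection_ordered_mono)
  moreover have "ereal (max \<kappa>1 \<kappa>2) < R" using \<kappa>1 \<kappa>2 by (simp add: max_def)
  ultimately show ?thesis using \<kappa>1(1) by (intro exI[of _ "max \<kappa>1 \<kappa>2"]) auto
qed

lemma ordered_mono: "ordered \<kappa> \<Longrightarrow> \<kappa> \<le> \<mu> \<Longrightarrow> ordered \<mu>"
  unfolding ordered_def by (blast intro: reflection_ordered_mono)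

lemma
  assumes "ordered \<kappa>" "0 < r" "\<kappa> \<le> r" "ereal r < R"
  shows ordered_U1_nonneg: "0 \<le> U1 r" and ordered_V1_nonneg: "0 \<le> \<sigma> * V1 r"
proof -
  have ord: "reflection_ordered R U \<kappa>" "reflection_ordered R (\<lambda>r. \<sigma> * V r) \<kappa>"
    using assms(1) by (auto simp: ordered_def)
  show "0 \<le> U1 r" "0 \<le> \<sigma> * V1 r"
    using reflection_ordered_deriv_nonneg[OF ord(1) assms(2-4) dU[OF assms(2,4)]]
      reflection_ordered_deriv_nonneg[OF ord(2) assms(2-4) dW[OF assms(2,4)]] by blast+
qed

text \<open>If \<open>U1 \<kappa>\<close> vanished, the order relation would force \<open>U3 \<kappa> \<ge> 0\<close>, against the equation.\<close>

lemma ordered_U1_pos: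
  assumes ord: "ordered \<kappa>" and \<kappa>: "0 < \<kappa>" "ereal \<kappa> < R"
  shows "0 < U1 \<kappa>"
proof (rule ccontr)
  assume "\<not> 0 < U1 \<kappa>"
  then have "U1 \<kappa> \<le> 0" by simp
  moreover have "reflection_ordered R U \<kappa>" using ord by (simp add: ordered_def)
  ultimately have h: "U1 \<kappa> = 0" "0 \<le> U2 \<kappa>" "0 \<le> U3 \<kappa>"
    using reflection_ordered_hopf[OF _ \<kappa> dU dU1 dU2[OF \<kappa>]] by blast+
  have "0 \<le> coup \<kappa> * (\<sigma> * V1 \<kappa>)"
    using coup_nonneg[OF \<kappa>] ordered_V1_nonneg[OF ord \<kappa>(1) order_refl \<kappa>(2)] by (rule mult_nonneg_nonneg)
  moreover have "0 < 2 * K * U \<kappa> / \<kappa>^3" using K U_pos \<kappa> by simp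
  moreover have "0 \<le> U2 \<kappa> / \<kappa>" using h \<kappa> by simp
  ultimately show False using h(3) unfolding U3_def h(1) by linarith
qed

text \<open>The contradiction is that for \<open>U\<close>, but the negative term is now
  \<open>- 3 coup U1\<close>, which requires \<open>ordered_U1_pos\<close>.\<close>

lemma ordered_V1_pos:
  assumes ne: "\<beta> \<noteq> 2 * \<gamma>" and ord: "ordered \<kappa>" and \<kappa>: "0 < \<kappa>" "ereal \<kappa> < R"
  shows "0 < \<sigma> * V1 \<kappa>"
proof (rule ccontr)
  assume "\<not> 0 < \<sigma> * V1 \<kappa>"
  then have "\<sigma> * V1 \<kappa> \<le> 0" by simp
  moreover have "reflection_ordered R (\<lambda>r. \<sigma> * V r) \<kappa>" using ord by (simp add: ordered_def)
  ultimately have h: "\<sigma> * V1 \<kappa> = 0" "0 \<le> \<sigma> * V2 \<kappa>" "0 \<le> \<sigma> * V3 \<kappa>"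
    using reflection_ordered_hopf[OF _ \<kappa> dW dW1 dW2[OF \<kappa>]] by blast+
  have "0 < 3 * coup \<kappa> * U1 \<kappa>" using coup_pos[OF ne \<kappa>] ordered_U1_pos[OF ord \<kappa>] by simp
  moreover have "0 \<le> \<sigma> * V2 \<kappa> / \<kappa>" using h(2) \<kappa>(1) by (rule divide_nonneg_pos)
  ultimately show False using h(3) unfolding sign_V3 h(1) by linarith
qed

text \<open>At a contact every difference between the two equations favours the inner point: the
  centrifugal term is strictly larger there, the reflected drift has the good sign, and the coupling
  does no harm. This gives \<open>U2 r > U2 \<rho>\<close>, against
  \<open>reflection_ordered_touch\<close>.\<close>

lemma ordered_U_strict:
  assumes ord: "ordered \<kappa>" and r: "0 < r" "r < \<rho>" "ereal \<rho> < R" "r + \<rho> = 2 * \<kappa>"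
  shows "U r < U \<rho>"
proof (rule ccontr)
  assume "\<not> U r < U \<rho>"
  moreover have le: "U r \<le> U \<rho>" "\<sigma> * V r \<le> \<sigma> * V \<rho>"
    using ord r reflection_orderedD[of R U \<kappa> r \<rho>] reflection_orderedD[of R "\<lambda>r. \<sigma> * V r" \<kappa> r \<rho>]
    by (auto simp: ordered_def)
  ultimately have eq: "U r = U \<rho>" by simp
  have dom: "0 < \<rho>" "ereal r < R" using r less_R[of r \<rho>] by auto
  have t: "U1 r = - U1 \<rho>" "U2 r \<le> U2 \<rho>" "0 \<le> U1 \<rho>"
    using reflection_ordered_touch[OF _ r dU dU1 eq] ord by (auto simp: ordered_def)
  have "hn \<beta> \<gamma> (U r) (V \<rho>) \<le> hn \<beta> \<gamma> (U r) (V r)"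
    using hn_antimono[of "U r" "V r" "V \<rho>"] le U_pos[OF r(1) dom(2)] V_sign_le[OF dom(1) r(3)] by simp
  moreover have "K * U r / \<rho>^2 < K * U r / r^2"
    using K U_pos[OF r(1) dom(2)] r by (intro divide_strict_left_mono power_strict_mono) auto
  moreover have "0 \<le> U1 \<rho> / \<rho>" "0 \<le> U1 \<rho> / r" using t(3) r dom by simp_all
  moreover have "U1 r / r = - (U1 \<rho> / r)" using t(1) by simp
  ultimately show False
    using t(2) U_eq[OF r(1) dom(2)] U_eq[OF dom(1) r(3)] eq by simp
qed

text \<open>There is no centrifugal term here: strictness comes from \<open>U r < U \<rho>\<close>
  through the nondegenerate coupling.\<close>

lemma ordered_V_strict:
  assumes ne: "\<beta> \<noteq> 2 * \<gamma>" and ord: "ordered \<kappa>"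
    and r: "0 < r" "r < \<rho>" "ereal \<rho> < R" "r + \<rho> = 2 * \<kappa>"
  shows "\<sigma> * V r < \<sigma> * V \<rho>"
proof (rule ccontr)
  assume "\<not> \<sigma> * V r < \<sigma> * V \<rho>"
  moreover have "\<sigma> * V r \<le> \<sigma> * V \<rho>"
    using ord r reflection_orderedD[of R "\<lambda>r. \<sigma> * V r" \<kappa> r \<rho>] by (auto simp: ordered_def)
  ultimately have eq: "\<sigma> * V r = \<sigma> * V \<rho>" by simp
  then have eq': "V r = V \<rho>" using sign by auto
  have dom: "0 < \<rho>" "ereal r < R" using r less_R[of r \<rho>] by auto
  have t: "\<sigma> * V1 r = - (\<sigma> * V1 \<rho>)" "\<sigma> * V2 r \<le> \<sigma> * V2 \<rho>" "0 \<le> \<sigma> * V1 \<rho>"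
    using reflection_ordered_touch[OF _ r dW dW1 eq] ord by (auto simp: ordered_def)
  have "\<sigma> * gn \<beta> \<gamma> (U \<rho>) (V r) < \<sigma> * gn \<beta> \<gamma> (U r) (V r)"
    using gn_antimono_strict[OF ne _ ordered_U_strict[OF ord r]] U_pos[OF r(1) dom(2)]
      V_sign_le[OF r(1) dom(2)] by simp
  moreover have "0 \<le> \<sigma> * V1 \<rho> / \<rho>" "0 \<le> \<sigma> * V1 \<rho> / r" using t(3) r dom by simp_all
  moreover have "\<sigma> * V1 r / r = - (\<sigma> * V1 \<rho> / r)" unfolding t(1) by simp
  moreover have "\<sigma> * V2 r = \<sigma> * gn \<beta> \<gamma> (U r) (V r) - \<sigma> * V1 r / r"
    using V_eq[OF r(1) dom(2)] by (simp add: right_diff_distrib)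
  moreover have "\<sigma> * V2 \<rho> = \<sigma> * gn \<beta> \<gamma> (U \<rho>) (V r) - \<sigma> * V1 \<rho> / \<rho>"
    using V_eq[OF dom(1) r(3)] eq' by (simp add: right_diff_distrib)
  ultimately show False using t(2) by linarith
qed

text \<open>With inner point 0 a contact is only one-sided. Since \<open>V1\<close> tends to 0 at
  the centre while \<open>\<sigma> V1 (2 * \<kappa>) > 0\<close>, the reflected difference decreases
  from its value at 0; without strictness it would be negative for small
  \<open>x > 0\<close>.\<close>

lemma ordered_V_strict_0:
  assumes ne: "\<beta> \<noteq> 2 * \<gamma>" and ord: "ordered \<kappa>" and \<kappa>: "0 < \<kappa>" "ereal (2 * \<kappa>) < R"
  shows "\<sigma> * V 0 < \<sigma> * V (2 * \<kappa>)"
proof (rule ccontr)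
  assume le: "\<not> \<sigma> * V 0 < \<sigma> * V (2 * \<kappa>)"
  define b where "b x = \<sigma> * V (2 * \<kappa> - x) - \<sigma> * V x" for x
  have \<kappa>2: "0 < 2 * \<kappa>" using \<kappa> by simp
  have dom: "0 < 2 * \<kappa> - x" "ereal x < R" "ereal (2 * \<kappa> - x) < R" if "0 < x" "x < \<kappa>" for x
    using that \<kappa> less_R[of x "2 * \<kappa>"] less_R[of "2 * \<kappa> - x" "2 * \<kappa>"] by auto
  have db: "(b has_real_derivative \<sigma> * V1 (2 * \<kappa> - x) * (- 1) - \<sigma> * V1 x) (at x)"
    if "0 < x" "x < \<kappa>" for x
    unfolding b_def
  proof (rule DERIV_diff)
    have "((\<lambda>x. 2 * \<kappa> - x) has_real_derivative - 1) (at x)"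
      by (auto intro!: derivative_eq_intros)
    then show "((\<lambda>x. \<sigma> * V (2 * \<kappa> - x)) has_real_derivative \<sigma> * V1 (2 * \<kappa> - x) * (- 1)) (at x)"
      by (rule DERIV_chain2[where f = "\<lambda>r. \<sigma> * V r" and g = "\<lambda>x. 2 * \<kappa> - x",
            OF dW[OF dom(1,3)[OF that]]])
    show "((\<lambda>x. \<sigma> * V x) has_real_derivative \<sigma> * V1 x) (at x)"
      by (rule dW[OF that(1) dom(2)[OF that]])
  qed
  \<comment> \<open>\<open>2 * \<kappa>\<close> is itself an admissible mirror, so
    \<open>ordered_V1_pos\<close> applies there.\<close>
  have pos: "0 < \<sigma> * V1 (2 * \<kappa>)"
    using ordered_V1_pos[OF ne ordered_mono[OF ord] \<kappa>2 \<kappa>(2)] \<kappa> by simp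
  have "isCont (\<lambda>x. \<sigma> * V1 (2 * \<kappa> - x)) 0"
  proof (rule isCont_o2[where f = "\<lambda>x. 2 * \<kappa> - x" and g = "\<lambda>r. \<sigma> * V1 r"])
    show "isCont (\<lambda>x. 2 * \<kappa> - x) 0" by simp
    show "isCont (\<lambda>r. \<sigma> * V1 r) (2 * \<kappa> - 0)" using DERIV_isCont[OF dW1[OF \<kappa>2 \<kappa>(2)]] by simp
  qed
  then have "((\<lambda>x. \<sigma> * V1 (2 * \<kappa> - x)) \<longlongrightarrow> \<sigma> * V1 (2 * \<kappa>)) (at_right 0)"
    unfolding isCont_def filterlim_at_split by (elim conjE) (simp only: diff_zero)
  from tendsto_diff[OF tendsto_mult[OF this tendsto_const] tendsto_mult[OF tendsto_const V1_0]]
  have "((\<lambda>x. \<sigma> * V1 (2 * \<kappa> - x) * (- 1) - \<sigma> * V1 x) \<longlongrightarrow> \<sigma> * V1 (2 * \<kappa>) * (- 1) - \<sigma> * 0) (at_right 0)" .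
  then have "eventually (\<lambda>x. \<sigma> * V1 (2 * \<kappa> - x) * (- 1) - \<sigma> * V1 x < 0) (at_right 0)"
    by (rule order_tendstoD(2)) (use pos in simp)
  then obtain d where d: "0 < d" "\<And>x. 0 < x \<Longrightarrow> x < d \<Longrightarrow> \<sigma> * V1 (2 * \<kappa> - x) * (- 1) - \<sigma> * V1 x < 0"
    by (auto simp: eventually_at_right_field)
  define x where "x = min d \<kappa> / 2"
  have x: "0 < x" "x < d" "x < \<kappa>" using d \<kappa> by (auto simp: x_def)
  have "b x < b 0"
  proof (rule DERIV_neg_imp_decreasing_open[OF x(1)])
    show "\<exists>y. DERIV b z :> y \<and> y < 0" if "0 < z" "z < x" for z
      using db[of z] d(2)[of z] that x by auto
    show "continuous_on {0..x} b"
      unfolding b_def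
    proof (rule continuous_on_diff)
      have le: "ereal z \<le> R" if "z \<le> 2 * \<kappa>" for z using less_R[OF that \<kappa>(2)] by simp
      show "continuous_on {0..x} (\<lambda>r. \<sigma> * V r)"
        by (rule continuous_on_subset[OF W_cont]) (use x le in auto)
      show "continuous_on {0..x} (\<lambda>z. \<sigma> * V (2 * \<kappa> - z))"
        by (rule continuous_on_compose2[OF W_cont, of _ "\<lambda>z. 2 * \<kappa> - z"])
          (use x le in \<open>auto intro!: continuous_intros\<close>)
    qed
  qed
  moreover have "b 0 \<le> 0" using le by (simp add: b_def)
  moreover have "0 \<le> b x"
    using ord x dom[OF x(1,3)] reflection_orderedD[of R "\<lambda>r. \<sigma> * V r" \<kappa> x "2 * \<kappa> - x"]
    by (simp add: b_def ordered_def)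
  ultimately show False by simp
qed

lemma ordered_open:
  assumes ord: "ordered \<kappa>" and \<kappa>: "0 < \<kappa>" "ereal \<kappa> < R"
  shows "\<exists>\<epsilon>>0. ordered (\<kappa> - \<epsilon>)"
proof -
  have radius: "\<exists>d>0. \<forall>x. \<bar>x - \<kappa>\<bar> < d \<longrightarrow> 0 < x \<and> ereal x < R \<and> 0 < f x"
    if f: "0 < f \<kappa>" "isCont f \<kappa>" for f :: "real \<Rightarrow> real"
  proof -
    obtain d where d: "0 < d" "\<And>y. \<bar>y - \<kappa>\<bar> < d \<Longrightarrow> 0 < y \<and> ereal y < R"
      using obtain_radius[OF \<kappa>] by blast
    have "eventually (\<lambda>x. 0 < f x) (nhds \<kappa>)"
      using f by (intro order_tendstoD(1)) (auto simp: isCont_def tendsto_at_iff_tendsto_nhds)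
    then obtain e where "e > 0" "\<And>x. dist x \<kappa> < e \<Longrightarrow> 0 < f x" by (auto simp: eventually_nhds_metric)
    then show ?thesis using d by (intro exI[of _ "min d e"]) (auto simp: dist_real_def)
  qed
  have "\<exists>\<epsilon>>0. reflection_ordered R U (\<kappa> - \<epsilon>)"
  proof -
    obtain d where d: "d > 0" "\<And>x. \<bar>x - \<kappa>\<bar> < d \<Longrightarrow> 0 < x \<and> ereal x < R \<and> 0 < U1 x"
      using radius[OF ordered_U1_pos[OF ord \<kappa>] DERIV_isCont[OF dU1[OF \<kappa>]]] by blast
    show ?thesis
    proof (rule reflection_ordered_open[OF U_cont _ _ d(1) dU])
      fix r \<rho> assume r: "0 \<le> r" "r < \<rho>" "ereal \<rho> \<le> R" "r + \<rho> = 2 * \<kappa>"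
      show "U r < U \<rho>"
      proof (cases "ereal \<rho> = R")
        case True
        then have "ereal r < R" using r by (metis less_ereal.simps(1))
        then show ?thesis using U_less_1[of r] U_end[OF True] U_0 r by (cases "r = 0") auto
      next
        case False
        then show ?thesis
          using ordered_U_strict[OF ord, of r \<rho>] U_pos[of \<rho>] U_0 r by (cases "r = 0") auto
      qed
    qed (use ord d in \<open>auto simp: ordered_def\<close>)
  qed
  then obtain \<epsilon>1 where e1: "\<epsilon>1 > 0" "reflection_ordered R U (\<kappa> - \<epsilon>1)" by blast
  have "\<exists>\<epsilon>>0. reflection_ordered R (\<lambda>r. \<sigma> * V r) (\<kappa> - \<epsilon>)"
  proof (cases "\<beta> = 2 * \<gamma>")
    case True
    \<comment> \<open>A constant \<open>V\<close> is ordered for every mirror; the step 1 is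
      arbitrary.\<close>
    have "reflection_ordered R (\<lambda>r. \<sigma> * V r) (\<kappa> - 1)"
      unfolding reflection_ordered_def
      using V_const[OF True] by (metis ereal_less_eq(3) order_refl order_trans)
    then show ?thesis by (intro exI[of _ 1]) simp
  next
    case ne: False
    obtain d where d: "d > 0" "\<And>x. \<bar>x - \<kappa>\<bar> < d \<Longrightarrow> 0 < x \<and> ereal x < R \<and> 0 < \<sigma> * V1 x"
      using radius[OF ordered_V1_pos[OF ne ord \<kappa>] DERIV_isCont[OF dW1[OF \<kappa>]]] by blast
    show ?thesis
    proof (rule reflection_ordered_open[OF W_cont _ _ d(1) dW])
      fix r \<rho> assume r: "0 \<le> r" "r < \<rho>" "ereal \<rho> \<le> R" "r + \<rho> = 2 * \<kappa>"
      show "\<sigma> * V r < \<sigma> * V \<rho>"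
      proof (cases "ereal \<rho> = R")
        case True
        then have "ereal r < R" using r by (metis less_ereal.simps(1))
        then show ?thesis
          using V_sign_less[OF ne, of r] V_sign_less_0[OF ne] V_end[OF True] r by (cases "r = 0") auto
      next
        case False
        then show ?thesis
          using ordered_V_strict[OF ne ord, of r \<rho>] ordered_V_strict_0[OF ne ord \<kappa>(1)] r
          by (cases "r = 0") auto
      qed
    qed (use ord d in \<open>auto simp: ordered_def\<close>)
  qed
  then obtain \<epsilon>2 where e2: "\<epsilon>2 > 0" "reflection_ordered R (\<lambda>r. \<sigma> * V r) (\<kappa> - \<epsilon>2)" by blast
  have "ordered (\<kappa> - min \<epsilon>1 \<epsilon>2)"
    unfolding ordered_def using e1 e2 by (auto intro: reflection_ordered_mono)
  then show ?thesis using e1 e2 by (intro exI[of _ "min \<epsilon>1 \<epsilon>2"]) simp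
qed

text \<open>The infimum of the admissible mirrors would be admissible by closedness and could be
  lowered by openness.\<close>

lemma ordered_all:
  assumes "0 < \<kappa>" "ereal \<kappa> < R"
  shows "ordered \<kappa>"
proof (rule ccontr)
  assume not: "\<not> ordered \<kappa>"
  define S where "S = {\<mu>. 0 < \<mu> \<and> ereal \<mu> < R \<and> ordered \<mu>}"
  obtain \<mu>0 where \<mu>0: "\<mu>0 \<in> S" using ordered_near_end by (auto simp: S_def)
  have lb: "\<kappa> \<le> \<mu>" if "\<mu> \<in> S" for \<mu>
    using that not ordered_mono[of \<mu> \<kappa>] by (cases "\<mu> \<le> \<kappa>") (auto simp: S_def)
  define m where "m = Inf S"
  have bdd: "bdd_below S" using lb by (auto simp: bdd_below_def)
  have m: "\<kappa> \<le> m" unfolding m_def using \<mu>0 lb by (intro cInf_greatest) auto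
  have "m \<le> \<mu>0" unfolding m_def by (rule cInf_lower[OF \<mu>0 bdd])
  then have mR: "ereal m < R" using \<mu>0 less_R[of m \<mu>0] by (auto simp: S_def)
  have "ordered \<mu>" if less: "m < \<mu>" for \<mu>
  proof -
    obtain \<nu> where "\<nu> \<in> S" "\<nu> < \<mu>"
      using less cInf_less_iff[OF _ bdd, of \<mu>] \<mu>0 unfolding m_def by blast
    then show ?thesis using ordered_mono[of \<nu> \<mu>] by (simp add: S_def)
  qed
  then have "ordered m"
    unfolding ordered_def
    using reflection_ordered_closed[OF U_cont, of m] reflection_ordered_closed[OF W_cont, of m]
    by blast
  then obtain \<epsilon> where e: "\<epsilon> > 0" "ordered (m - \<epsilon>)"
    using ordered_open[OF _ _ mR] m assms by auto
  \<comment> \<open>\<open>m / 2\<close> keeps the new mirror positive and hence in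
    \<open>S\<close>.\<close>
  define \<mu> where "\<mu> = max (m - \<epsilon>) (m / 2)"
  have "\<mu> < m" "0 < \<mu>" using e(1) m assms by (auto simp: \<mu>_def)
  moreover have "ordered \<mu>" using ordered_mono[OF e(2)] by (simp add: \<mu>_def)
  ultimately have "\<mu> \<in> S" using less_R[of \<mu> m] mR by (simp add: S_def)
  then have "m \<le> \<mu>" unfolding m_def by (rule cInf_lower[OF _ bdd])
  then show False using \<open>\<mu> < m\<close> by simp
qed

lemma U1_pos: "0 < r \<Longrightarrow> ereal r < R \<Longrightarrow> 0 < U1 r"
  using ordered_U1_pos ordered_all by blast

lemma V1_pos: "\<beta> \<noteq> 2 * \<gamma> \<Longrightarrow> 0 < r \<Longrightarrow> ereal r < R \<Longrightarrow> 0 < \<sigma> * V1 r"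
  using ordered_V1_pos ordered_all by blast

end

section \<open>Reduction to the normalised system\<close>

text \<open>The theorem prescribes only the limit of \<open>v1\<close> at the centre, so a value of
  \<open>v\<close> there has to be produced. A bounded derivative makes \<open>f\<close> Lipschitz
  near 0, and it extends continuously.\<close>

lemma tendsto_at_right_0_of_deriv:
  fixes f f1 :: "real \<Rightarrow> real"
  assumes z: "0 < z" and df: "\<And>r. 0 < r \<Longrightarrow> r < z \<Longrightarrow> (f has_real_derivative f1 r) (at r)"
    and lim: "(f1 \<longlongrightarrow> 0) (at_right 0)"
  obtains l where "(f \<longlongrightarrow> l) (at_right 0)"
proof -
  obtain d where d: "0 < d" "\<And>r. 0 < r \<Longrightarrow> r < d \<Longrightarrow> \<bar>f1 r\<bar> < 1"
    using tendstoD[OF lim, of 1] by (auto simp: eventually_at_right_field dist_real_def)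
  define e where "e = min d z"
  have e: "0 < e" using d z by (simp add: e_def)
  have lip: "norm (f x - f y) \<le> 1 * norm (x - y)" if "x \<in> {0<..<e}" "y \<in> {0<..<e}" for x y
  proof (rule field_differentiable_bound[OF _ _ _ that])
    show "(f has_field_derivative f1 w) (at w within {0<..<e})" "norm (f1 w) \<le> 1"
      if "w \<in> {0<..<e}" for w
      using that df[of w] d(2)[of w] by (auto simp: e_def intro: has_field_derivative_at_within)
  qed simp
  have "uniformly_continuous_on {0<..<e} f"
    unfolding uniformly_continuous_on_def
  proof (intro allI impI)
    fix \<epsilon> :: real assume "0 < \<epsilon>"
    then show "\<exists>d>0. \<forall>x\<in>{0<..<e}. \<forall>x'\<in>{0<..<e}. dist x' x < d \<longrightarrow> dist (f x') (f x) < \<epsilon>"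
      using lip by (intro exI[of _ \<epsilon>]) (fastforce simp: dist_real_def)
  qed
  moreover have "0 \<in> closure {0<..<e}" using e by simp
  ultimately obtain l where "(f \<longlongrightarrow> l) (at 0 within {0<..<e})"
    using uniformly_continuous_on_extension_at_closure by blast
  moreover have "at 0 within {0<..<e} = at_right (0::real)"
    using e by (intro at_within_nhd[of _ "{..<e}"]) auto
  ultimately show thesis using that by simp
qed

text \<open>Boundary values in the theorem are limits; attaching them as values lets reflected pairs
  reach 0 and a finite \<open>R\<close>.\<close>

definition closed_extension :: "real \<Rightarrow> real \<Rightarrow> ereal \<Rightarrow> (real \<Rightarrow> real) \<Rightarrow> real \<Rightarrow> real" where
  "closed_extension l L R f r = (if r \<le> 0 then l else if ereal r < R then f r else L)"

lemma closed_extension_eq [simp]: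
  "0 < r \<Longrightarrow> ereal r < R \<Longrightarrow> closed_extension l L R f r = f r"
  by (simp add: closed_extension_def)

lemma closed_extension_deriv:
  assumes r: "0 < r" "ereal r < R" and df: "(f has_real_derivative D) (at r)"
  shows "(closed_extension l L R f has_real_derivative D) (at r)"
proof -
  obtain d where d: "0 < d" "\<And>y. \<bar>y - r\<bar> < d \<Longrightarrow> 0 < y \<and> ereal y < R"
    using obtain_radius[OF r] by blast
  show ?thesis
    by (rule has_field_derivative_transform_within[OF df d(1)])
      (use d(2) in \<open>auto simp: dist_real_def\<close>)
qed

lemma closed_extension_lim:
  assumes R: "0 < R" and lim: "(f \<longlongrightarrow> L) (end_filter R)"
  shows "(closed_extension l L R f \<longlongrightarrow> L) (end_filter R)"
proof -
  have "eventually (\<lambda>r. f r = closed_extension l L R f r) (end_filter R)"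
    unfolding eventually_end_filter[OF R]
    using ereal_dense2[of 0 R] R by (auto simp: zero_ereal_def)
  then show ?thesis using lim by (rule Lim_transform_eventually[rotated])
qed

lemma closed_extension_cont:
  assumes R: "0 < R"
    and df: "\<And>r. 0 < r \<Longrightarrow> ereal r < R \<Longrightarrow> (f has_real_derivative f1 r) (at r)"
    and lim0: "(f \<longlongrightarrow> l) (at_right 0)" and lim: "(f \<longlongrightarrow> L) (end_filter R)"
  shows "continuous_on {r. 0 \<le> r \<and> ereal r \<le> R} (closed_extension l L R f)"
  unfolding continuous_on_eq_continuous_within
proof
  let ?g = "closed_extension l L R f" and ?D = "{r. 0 \<le> r \<and> ereal r \<le> R}"
  fix x assume "x \<in> ?D"
  then consider "x = 0" | "0 < x" "ereal x < R" | "0 < x" "ereal x = R" by fastforce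
  then show "continuous (at x within ?D) ?g"
  proof cases
    case 1
    obtain z where z: "ereal 0 < ereal z" "ereal z < R"
      using ereal_dense2[of "ereal 0" R] R by (auto simp: zero_ereal_def)
    have "f y = ?g y" if "0 < y" "y < z" for y
      using that z less_trans[of "ereal y" "ereal z" R] by simp
    then have "eventually (\<lambda>r. f r = ?g r) (at_right 0)"
      unfolding eventually_at_right_field using z by (intro exI[of _ z]) auto
    then have "(?g \<longlongrightarrow> l) (at_right 0)" using lim0 by (rule Lim_transform_eventually[rotated])
    moreover have "at 0 within ?D \<le> at_right 0"
      by (subst at_within_nhd[of 0 UNIV ?D "?D - {0}"]) (auto intro!: at_le)
    ultimately show ?thesis
      using 1 tendsto_mono by (fastforce simp: continuous_within closed_extension_def)
  next
    case 2
    then show ?thesis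
      using DERIV_isCont[OF closed_extension_deriv[OF 2 df[OF 2]]] continuous_at_imp_continuous_within
      by blast
  next
    case 3
    have "(?g \<longlongrightarrow> L) (at_left x)"
      using closed_extension_lim[OF R lim, of l] 3(2) by (auto simp: end_filter_def)
    moreover have "at x within ?D \<le> at_left x"
      using 3(2) by (subst at_within_nhd[of x UNIV ?D "?D - {x}"]) (auto intro!: at_le)
    ultimately show ?thesis
      using 3 tendsto_mono by (fastforce simp: continuous_within closed_extension_def)
  qed
qed

lemma s_plus_pos:
  assumes "0 < b^2" "0 < c^2"
  shows "0 < s_plus a b c"
  unfolding s_plus_def using assms by (intro divide_pos_pos add_pos_nonneg) auto

text \<open>The quadratic formula read backwards. The relation says that the prescribed end values
  are an equilibrium of \<open>hfun\<close> and \<open>gfun\<close>.\<close>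

lemma s_plus_root:
  assumes "0 < c^2"
  shows "2 * c^2 * (s_plus a b c)^2 = b^2 * s_plus a b c + 3 * a^2"
proof -
  define q where "q = sqrt (b^4 + 24 * a^2 * c^2)"
  have q: "q^2 = b^4 + 24 * a^2 * c^2" unfolding q_def by simp
  have s: "4 * c^2 * s_plus a b c = b^2 + q" using assms by (simp add: s_plus_def q_def)
  have "8 * c^2 * (2 * c^2 * (s_plus a b c)^2) = (4 * c^2 * s_plus a b c)^2"
    by (simp add: power2_eq_square)
  also have "\<dots> = b^4 + 2 * b^2 * q + q^2"
    unfolding s by (simp add: power2_eq_square eval_nat_numeral algebra_simps)
  also have "\<dots> = 2 * b^2 * (b^2 + q) + 24 * a^2 * c^2"
    unfolding q by (simp add: power2_eq_square eval_nat_numeral algebra_simps)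
  also have "\<dots> = 8 * c^2 * (b^2 * s_plus a b c + 3 * a^2)"
    unfolding s[symmetric] by (simp add: algebra_simps)
  finally have "8 * c^2 * (2 * c^2 * (s_plus a b c)^2) = 8 * c^2 * (b^2 * s_plus a b c + 3 * a^2)" .
  moreover have "8 * c^2 \<noteq> 0" using assms by simp
  ultimately show ?thesis using mult_left_cancel by blast
qed

text \<open>The factors \<open>sqrt 2 / s\<close> and \<open>- sqrt 6 / s\<close> divide by the end
  values and send them to \<open>(1, 1)\<close>; the negative one turns \<open>v < 0\<close> into a
  positive unknown.\<close>

lemma
  assumes s: "s \<noteq> 0" and a: "2 * c^2 * s^2 = b^2 * s + 3 * a^2"
  shows hfun_scaled: "sqrt 2 / s * hfun a b c x y =
      hn (b^2 * s / 3) (c^2 * s^2 / 6) (sqrt 2 / s * x) (- sqrt 6 / s * y)"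
    and gfun_scaled: "- sqrt 6 / s * gfun a b c x y =
      gn (b^2 * s / 3) (c^2 * s^2 / 6) (sqrt 2 / s * x) (- sqrt 6 / s * y)"
proof -
  define X where "X = sqrt 2 / s * x"
  define Y where "Y = - sqrt 6 / s * y"
  have x: "x = s * X / sqrt 2" and y: "y = - s * Y / sqrt 6" using s by (auto simp: X_def Y_def)
  have sq: "x^2 = s^2 * X^2 / 2" "y^2 = s^2 * Y^2 / 6"
    unfolding x y by (simp_all add: power_mult_distrib power_divide)
  have a': "a^2 = 4 * (c^2 * s^2 / 6) - b^2 * s / 3" using a by simp
  have r6: "sqrt 6 * sqrt 6 = 6" by simp
  have "sqrt (2/3) = 2 / sqrt 6"
    by (rule real_sqrt_unique) (simp_all add: power_divide)
  then have h: "sqrt (2/3) * b^2 * y = - (b^2 * s / 3) * Y"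
    unfolding y by (simp only:) (simp add: field_simps)
  have g: "1 / sqrt 6 * b^2 * y = - (b^2 * s / 3) / 2 * Y"
    unfolding y using r6 by (simp add: field_simps)
  show "sqrt 2 / s * hfun a b c x y = hn (b^2 * s / 3) (c^2 * s^2 / 6) X Y"
  proof -
    have "sqrt 2 / s * hfun a b c x y = X * (- (a^2) + sqrt (2/3) * b^2 * y + c^2 * (x^2 + y^2))"
      by (simp add: hfun_def X_def)
    then show ?thesis unfolding h sq a' hn_def by (simp add: algebra_simps)
  qed
  show "- sqrt 6 / s * gfun a b c x y = gn (b^2 * s / 3) (c^2 * s^2 / 6) X Y"
  proof -
    have "- sqrt 6 / s * gfun a b c x y =
        Y * (- (a^2) - 1 / sqrt 6 * b^2 * y + c^2 * (x^2 + y^2)) - b^2 / s * x^2"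
      using s by (simp add: gfun_def Y_def field_simps)
    also have "b^2 / s * x^2 = 3 * (b^2 * s / 3) / 2 * X^2"
      unfolding sq using s by (simp add: power2_eq_square)
    finally show ?thesis unfolding g sq a' gn_def by (simp add: algebra_simps)
  qed
qed

theorem mainTheorem2:
  fixes a b c :: real and k :: int and R :: ereal
    and u v u1 v1 u2 v2 :: "real \<Rightarrow> real"
  assumes b: "b^2 > 0" and c: "c^2 > 0" and k: "k \<noteq> 0" and R: "R > 0"
    and du: "\<And>r. 0 < r \<Longrightarrow> ereal r < R \<Longrightarrow> (u has_real_derivative u1 r) (at r)"
    and ddu: "\<And>r. 0 < r \<Longrightarrow> ereal r < R \<Longrightarrow> (u1 has_real_derivative u2 r) (at r)"
    and dv: "\<And>r. 0 < r \<Longrightarrow> ereal r < R \<Longrightarrow> (v has_real_derivative v1 r) (at r)"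
    and ddv: "\<And>r. 0 < r \<Longrightarrow> ereal r < R \<Longrightarrow> (v1 has_real_derivative v2 r) (at r)"
    and eq_u: "\<And>r. 0 < r \<Longrightarrow> ereal r < R \<Longrightarrow>
               u2 r + u1 r / r - (real_of_int k)^2 * u r / r^2 = hfun a b c (u r) (v r)"
    and eq_v: "\<And>r. 0 < r \<Longrightarrow> ereal r < R \<Longrightarrow>
               v2 r + v1 r / r = gfun a b c (u r) (v r)"
    and u0: "(u \<longlongrightarrow> 0) (at_right 0)"
    and v10: "(v1 \<longlongrightarrow> 0) (at_right 0)"
    and uR: "(u \<longlongrightarrow> s_plus a b c / sqrt 2) (end_filter R)"
    and vR: "(v \<longlongrightarrow> - s_plus a b c / sqrt 6) (end_filter R)"
    and upos: "\<And>r. 0 < r \<Longrightarrow> ereal r < R \<Longrightarrow> u r > 0"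
    and vneg: "\<And>r. 0 < r \<Longrightarrow> ereal r < R \<Longrightarrow> v r < 0"
  shows "(b^4 < 3 * a^2 * c^2 \<longrightarrow>
            (\<forall>r. 0 < r \<and> ereal r < R \<longrightarrow> u1 r > 0 \<and> v1 r > 0))
       \<and> (b^4 = 3 * a^2 * c^2 \<longrightarrow>
            (\<forall>r. 0 < r \<and> ereal r < R \<longrightarrow> u1 r > 0 \<and> v r = - s_plus a b c / sqrt 6))
       \<and> (b^4 > 3 * a^2 * c^2 \<longrightarrow>
            (\<forall>r. 0 < r \<and> ereal r < R \<longrightarrow> u1 r > 0 \<and> v1 r < 0))"
proof -
  define s where "s = s_plus a b c"
  have s: "0 < s" unfolding s_def by (rule s_plus_pos[OF b c])
  have root: "2 * c^2 * s^2 = b^2 * s + 3 * a^2" unfolding s_def by (rule s_plus_root[OF c])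
  define \<beta> where "\<beta> = b^2 * s / 3"
  define \<gamma> where "\<gamma> = c^2 * s^2 / 6"
  have \<beta>: "0 < \<beta>" using b s by (simp add: \<beta>_def)
  have \<gamma>: "0 < \<gamma>" using c s by (simp add: \<gamma>_def)
  have "4 * \<gamma> - \<beta> = a^2" using root by (simp add: \<beta>_def \<gamma>_def)
  then have \<beta>_le: "\<beta> \<le> 4 * \<gamma>" using zero_le_power2[of a] by linarith
  \<comment> \<open>The case distinction is the sign of \<open>b^2 - c^2 s\<close>:
    \<open>3 a^2 = s (2 c^2 s - b^2)\<close> turns the left side into
    \<open>(b^2 + 2 c^2 s) (b^2 - c^2 s)\<close>, while
    \<open>\<beta> - 2 \<gamma> = s (b^2 - c^2 s) / 3\<close>.\<close>
  have param: "b^4 - 3 * a^2 * c^2 = (3 * (b^2 + 2 * c^2 * s) / s) * (\<beta> - 2 * \<gamma>)"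
  proof -
    have "3 * a^2 = 2 * c^2 * s^2 - b^2 * s" using root by simp
    then have "b^4 - 3 * a^2 * c^2 = b^4 - (2 * c^2 * s^2 - b^2 * s) * c^2" by simp
    also have "\<dots> = (3 * (b^2 + 2 * c^2 * s) / s) * (\<beta> - 2 * \<gamma>)"
      using s by (simp add: \<beta>_def \<gamma>_def field_simps eval_nat_numeral)
    finally show ?thesis .
  qed
  have fac: "0 < 3 * (b^2 + 2 * c^2 * s) / s" using b c s by (simp add: add_pos_pos)
  have lt: "b^4 < 3 * a^2 * c^2 \<longleftrightarrow> \<beta> < 2 * \<gamma>" and gt: "3 * a^2 * c^2 < b^4 \<longleftrightarrow> 2 * \<gamma> < \<beta>"
    using param mult_less_0_iff[of "3 * (b^2 + 2 * c^2 * s) / s" "\<beta> - 2 * \<gamma>"]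
      zero_less_mult_iff[of "3 * (b^2 + 2 * c^2 * s) / s" "\<beta> - 2 * \<gamma>"] fac by linarith+
  obtain z where z: "ereal 0 < ereal z" "ereal z < R"
    using ereal_dense2[of "ereal 0" R] R by (auto simp: zero_ereal_def)
  obtain v0 where v0: "(v \<longlongrightarrow> v0) (at_right 0)"
    by (rule tendsto_at_right_0_of_deriv[of z v v1, OF _ dv v10])
      (use z in \<open>auto intro: less_trans[of _ "ereal z"]\<close>)
  define p where "p = sqrt 2 / s"
  define q where "q = - sqrt 6 / s"
  have p: "0 < p" and q: "q < 0" using s by (auto simp: p_def q_def)
  have pL: "p * (s_plus a b c / sqrt 2) = 1" and qL: "q * (- s_plus a b c / sqrt 6) = 1"
    using s by (auto simp: p_def q_def s_def[symmetric])
  define U where "U = closed_extension 0 1 R (\<lambda>r. p * u r)"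
  define V where "V = closed_extension (q * v0) 1 R (\<lambda>r. q * v r)"
  have U0: "((\<lambda>r. p * u r) \<longlongrightarrow> 0) (at_right 0)" using tendsto_mult[OF tendsto_const u0, of p] by simp
  have V0: "((\<lambda>r. q * v r) \<longlongrightarrow> q * v0) (at_right 0)" by (intro tendsto_intros v0)
  have UR: "((\<lambda>r. p * u r) \<longlongrightarrow> 1) (end_filter R)" using tendsto_mult[OF tendsto_const uR, of p] by (simp only: pL)
  have VR: "((\<lambda>r. q * v r) \<longlongrightarrow> 1) (end_filter R)" using tendsto_mult[OF tendsto_const vR, of q] by (simp only: qL)
  \<comment> \<open>\<open>\<sigma>\<close> stays free so that each case can choose its sign;
    \<open>q < 0\<close> reverses the direction of monotonicity between \<open>V\<close> and
    \<open>v\<close>.\<close>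
  have profile: "radial_profile \<beta> \<gamma> ((real_of_int k)^2) R U (\<lambda>r. p * u1 r) (\<lambda>r. p * u2 r)
      V (\<lambda>r. q * v1 r) (\<lambda>r. q * v2 r) \<sigma>"
    if sign: "\<sigma> = 1 \<or> \<sigma> = - 1" and sign_param: "0 \<le> \<sigma> * (\<beta> - 2 * \<gamma>)" for \<sigma>
  proof
    fix r :: real assume r: "0 < r" "ereal r < R"
    have UV: "U r = p * u r" "V r = q * v r" using r by (simp_all add: U_def V_def)
    show "(U has_real_derivative p * u1 r) (at r)" "(V has_real_derivative q * v1 r) (at r)"
      unfolding U_def V_def by (intro closed_extension_deriv[OF r] DERIV_cmult du dv r)+
    show "((\<lambda>r. p * u1 r) has_real_derivative p * u2 r) (at r)"
      "((\<lambda>r. q * v1 r) has_real_derivative q * v2 r) (at r)"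
      by (intro DERIV_cmult ddu ddv r)+
    have "p * hfun a b c (u r) (v r) = hn \<beta> \<gamma> (U r) (V r)"
      "q * gfun a b c (u r) (v r) = gn \<beta> \<gamma> (U r) (V r)"
      using hfun_scaled[OF _ root] gfun_scaled[OF _ root] s by (simp_all add: UV p_def q_def \<beta>_def \<gamma>_def)
    then show "p * u2 r = (real_of_int k)^2 * U r / r^2 + hn \<beta> \<gamma> (U r) (V r) - p * u1 r / r"
      "q * v2 r = gn \<beta> \<gamma> (U r) (V r) - q * v1 r / r"
      unfolding eq_u[OF r, symmetric] eq_v[OF r, symmetric] UV by (simp_all add: algebra_simps)
    show "0 < U r" "0 < V r" using upos[OF r] vneg[OF r] p q by (simp_all add: UV mult_neg_neg)
  next
    show "continuous_on {r. 0 \<le> r \<and> ereal r \<le> R} U"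
      unfolding U_def by (rule closed_extension_cont[OF R DERIV_cmult[OF du] U0 UR])
    show "continuous_on {r. 0 \<le> r \<and> ereal r \<le> R} V"
      unfolding V_def by (rule closed_extension_cont[OF R DERIV_cmult[OF dv] V0 VR])
    show "(U \<longlongrightarrow> 1) (end_filter R)" "(V \<longlongrightarrow> 1) (end_filter R)"
      unfolding U_def V_def by (rule closed_extension_lim[OF R] UR VR)+
    show "((\<lambda>r. q * v1 r) \<longlongrightarrow> 0) (at_right 0)"
      using tendsto_mult[OF tendsto_const v10, of q] by simp
    show "U 0 = 0" by (simp add: U_def closed_extension_def)
    show "U r = 1" "V r = 1" if "ereal r = R" for r
      using that R by (auto simp: U_def V_def closed_extension_def)
  qed (use \<beta> \<gamma> \<beta>_le k R sign sign_param in auto)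
  have u1_pos: "0 < u1 r" if r: "0 < r" "ereal r < R" for r
  proof (cases "2 * \<gamma> \<le> \<beta>")
    case True
    interpret radial_profile \<beta> \<gamma> "(real_of_int k)^2" R U "\<lambda>r. p * u1 r" "\<lambda>r. p * u2 r"
      V "\<lambda>r. q * v1 r" "\<lambda>r. q * v2 r" 1 by (rule profile) (use True in auto)
    show ?thesis using U1_pos[OF r] p by (simp add: zero_less_mult_iff)
  next
    case False
    interpret radial_profile \<beta> \<gamma> "(real_of_int k)^2" R U "\<lambda>r. p * u1 r" "\<lambda>r. p * u2 r"
      V "\<lambda>r. q * v1 r" "\<lambda>r. q * v2 r" "- 1" by (rule profile) (use False in auto)
    show ?thesis using U1_pos[OF r] p by (simp add: zero_less_mult_iff)
  qed
  moreover have "0 < v1 r" if less: "\<beta> < 2 * \<gamma>" and r: "0 < r" "ereal r < R" for r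
  proof -
    interpret radial_profile \<beta> \<gamma> "(real_of_int k)^2" R U "\<lambda>r. p * u1 r" "\<lambda>r. p * u2 r"
      V "\<lambda>r. q * v1 r" "\<lambda>r. q * v2 r" "- 1" by (rule profile) (use less in auto)
    show ?thesis using V1_pos[OF _ r] less q by (simp add: mult_less_0_iff)
  qed
  moreover have "v1 r < 0" if less: "2 * \<gamma> < \<beta>" and r: "0 < r" "ereal r < R" for r
  proof -
    interpret radial_profile \<beta> \<gamma> "(real_of_int k)^2" R U "\<lambda>r. p * u1 r" "\<lambda>r. p * u2 r"
      V "\<lambda>r. q * v1 r" "\<lambda>r. q * v2 r" 1 by (rule profile) (use less in auto)
    show ?thesis using V1_pos[OF _ r] less q by (simp add: zero_less_mult_iff)
  qed
  moreover have "v r = - s_plus a b c / sqrt 6" if eq: "\<beta> = 2 * \<gamma>" and r: "0 < r" "ereal r < R" for r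
  proof -
    interpret radial_profile \<beta> \<gamma> "(real_of_int k)^2" R U "\<lambda>r. p * u1 r" "\<lambda>r. p * u2 r"
      V "\<lambda>r. q * v1 r" "\<lambda>r. q * v2 r" 1 by (rule profile) (use eq in auto)
    have "q * v r = q * (- s_plus a b c / sqrt 6)"
      unfolding qL using V_const[OF eq, of r] r by (simp add: V_def)
    then show ?thesis using q by (simp only: mult_cancel_left) auto
  qed
  ultimately show ?thesis using lt gt by force
qed

end
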